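(* Consider minimizing $f(x)$ subject to $g(x)\in\Theta$, where $\Theta\subset\mathbb{R}^m$ is a convex polyhedron, $f:\mathbb{R}^n\to\mathbb{R}$ and $g:\mathbb{R}^n\to\mathbb{R}^m$ are $\mathcal C^2$-smooth around a feasible $\bar x$, MSCQ holds at $\bar x$, and there is $\bar y\in N_\Theta(g(\bar x))$ with $\nabla f(\bar x)+\nabla g(\bar x)^*\bar y=0$. Let $\varphi:=f+\delta_\Gamma$. (i) If there are neighborhoods $U$ of $\bar x$ and $V$ of $0$ such that $\langle\nabla^2f(x)w,w\rangle+\langle w,\nabla^2\langle y,g\rangle(x)w\rangle\ge0$ for all $x\in U$, $v\in V$, $w\in-K_\Gamma(x,v-\nabla f(x))$ and $y\in\Lambda(x,v)$, then $\varphi$ is variationally convex at $\bar x$ for $0$; consequently $\bar x$ is a local minimizer of the problem. (ii) If there are $\sigma>0$ and neighborhoods $U$ of $\bar x$ and $V$ of $0$ such that $\langle\nabla^2f(x)w,w\rangle+\langle w,\nabla^2\langle y,g\rangle(x)w\rangle\ge\sigma\|w\|^2$ for all $x\in U$, $v\in V$, $w\in-K_\Gamma(x,v-\nabla f(x))$ and $y\in\Lambda(x,v)$, then $\varphi$ is strongly variationally convex at $\bar x$ for $0$ with modulus $\sigma$; consequently $\bar x$ is a tilt-stable local minimizer of $\varphi$ with modulus $\sigma^{-1}$, in particular a strong local minimizer of the problem.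
   Context: $\Gamma:=\{x:g(x)\in\Theta\}$, $\delta_\Gamma$ its indicator function; $\Lambda(x,v):=\{y:v=\nabla f(x)+\nabla g(x)^*y,\ y\in N_\Theta(g(x))\}$. MSCQ at $\bar x$: $\operatorname{dist}(x;\Gamma)\le\kappa\operatorname{dist}(g(x);\Theta)$ for some $\kappa>0$ and all $x$ near $\bar x$. Tangent cone $T_\Gamma(x):=\{w:\exists t_k\downarrow0,w_k\to w,x+t_kw_k\in\Gamma\}$; critical cone $K_\Gamma(x,u):=T_\Gamma(x)\cap\{u\}^\perp$. Variational convexity of l.s.c. $\varphi$ at $\bar x$ for $\bar v\in\partial\varphi(\bar x)$ ($\partial$ the limiting subdifferential): there exist a convex neighborhood $U\times V$ of $(\bar x,\bar v)$, $\varepsilon>0$ and an l.s.c. convex $\psi\le\varphi$ on $U$ with $(U_\varepsilon\times V)\cap\operatorname{gph}\partial\varphi=(U\times V)\cap\operatorname{gph}\partial\psi$ and $\varphi=\psi$ at common elements, where $U_\varepsilon:=\{x\in U:\varphi(x)<\varphi(\bar x)+\varepsilon\}$; strong variational convexity with modulus $\sigma$: the same with $\psi$ strongly convex on $U$ with modulus $\sigma$. Tilt-stable local minimizer: there is $\gamma>0$ such that $M_\gamma(v):=\operatorname{argmin}\{\varphi(x)-\langle v,x\rangle:\|x-\bar x\|\le\gamma\}$ is single-valued and Lipschitz continuous on a neighborhood of $0$ with $M_\gamma(0)=\{\bar x\}$; its modulus is a Lipschitz constant of $M_\gamma$ there. *)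

theory Defs
  imports "HOL-Analysis.Analysis"
begin

definition indicator_ext :: "'a set \<Rightarrow> 'a \<Rightarrow> ereal" where
  "indicator_ext C x = (if x \<in> C then 0 else \<infinity>)"

text \<open>Normal cone of convex analysis (Theta is convex); empty outside the set.\<close>
definition normal_cone :: "'a::real_inner set \<Rightarrow> 'a \<Rightarrow> 'a set" where
  "normal_cone C u = (if u \<in> C then {y. \<forall>z\<in>C. y \<bullet> (z - u) \<le> 0} else {})"

definition tangent_cone :: "'a::real_normed_vector set \<Rightarrow> 'a \<Rightarrow> 'a set" where
  "tangent_cone C x = {w. \<exists>t ws. (\<forall>k. t k > 0) \<and> t \<longlonglongrightarrow> 0 \<and> ws \<longlonglongrightarrow> w
                          \<and> (\<forall>k. x + t k *\<^sub>R ws k \<in> C)}"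

definition critical_cone :: "'a::real_inner set \<Rightarrow> 'a \<Rightarrow> 'a \<Rightarrow> 'a set" where
  "critical_cone C x u = tangent_cone C x \<inter> {w. w \<bullet> u = 0}"

text \<open>Regular (Frechet) subdifferential: phi x finite and
  liminf_{u->x} (phi u - phi x - <v,u-x>)/|u-x| >= 0, written in epsilon-delta form.\<close>
definition frechet_subdiff :: "('a::real_inner \<Rightarrow> ereal) \<Rightarrow> 'a \<Rightarrow> 'a set" where
  "frechet_subdiff \<phi> x = {v. \<bar>\<phi> x\<bar> \<noteq> \<infinity> \<and>
     (\<forall>\<epsilon>>0. \<exists>\<delta>>0. \<forall>u\<in>ball x \<delta>.
        \<phi> x + ereal (v \<bullet> (u - x) - \<epsilon> * norm (u - x)) \<le> \<phi> u)}"

definition limiting_subdiff :: "('a::real_inner \<Rightarrow> ereal) \<Rightarrow> 'a \<Rightarrow> 'a set" where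
  "limiting_subdiff \<phi> x = {v. \<exists>xs vs. xs \<longlonglongrightarrow> x \<and> (\<lambda>k. \<phi> (xs k)) \<longlonglongrightarrow> \<phi> x
      \<and> vs \<longlonglongrightarrow> v \<and> (\<forall>k. vs k \<in> frechet_subdiff \<phi> (xs k))}"

definition gph_subdiff :: "('a::real_inner \<Rightarrow> ereal) \<Rightarrow> ('a \<times> 'a) set" where
  "gph_subdiff \<phi> = {(x, v). v \<in> limiting_subdiff \<phi> x}"

definition lsc_at :: "('a::topological_space \<Rightarrow> ereal) \<Rightarrow> 'a \<Rightarrow> bool" where
  "lsc_at \<psi> x \<longleftrightarrow> \<psi> x \<le> Liminf (at x) \<psi>"

definition ereal_convex_on :: "'a::real_vector set \<Rightarrow> ('a \<Rightarrow> ereal) \<Rightarrow> bool" where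
  "ereal_convex_on U \<psi> \<longleftrightarrow> convex {(x, \<alpha>::real). x \<in> U \<and> \<psi> x \<le> ereal \<alpha>}"

definition ereal_strongly_convex_on :: "'a::real_normed_vector set \<Rightarrow> real \<Rightarrow> ('a \<Rightarrow> ereal) \<Rightarrow> bool" where
  "ereal_strongly_convex_on U \<sigma> \<psi> \<longleftrightarrow>
     ereal_convex_on U (\<lambda>x. \<psi> x - ereal (\<sigma> / 2 * (norm x)\<^sup>2))"

definition var_convex_gen :: "(('a::euclidean_space) set \<Rightarrow> ('a \<Rightarrow> ereal) \<Rightarrow> bool)
     \<Rightarrow> ('a \<Rightarrow> ereal) \<Rightarrow> 'a \<Rightarrow> 'a \<Rightarrow> bool" where
  "var_convex_gen CVX \<phi> xb vb \<longleftrightarrow>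
     (\<exists>U V \<epsilon> \<psi>. open U \<and> convex U \<and> xb \<in> U \<and> open V \<and> convex V \<and> vb \<in> V \<and> \<epsilon> > 0
        \<and> CVX U \<psi> \<and> (\<forall>x\<in>U. lsc_at \<psi> x) \<and> (\<forall>x\<in>U. \<psi> x \<le> \<phi> x)
        \<and> (let U\<epsilon> = {x\<in>U. \<phi> x < \<phi> xb + ereal \<epsilon>} in
             (U\<epsilon> \<times> V) \<inter> gph_subdiff \<phi> = (U \<times> V) \<inter> gph_subdiff \<psi>
           \<and> (\<forall>(x, v) \<in> (U\<epsilon> \<times> V) \<inter> gph_subdiff \<phi>. \<phi> x = \<psi> x)))"

definition variationally_convex :: "('a::euclidean_space \<Rightarrow> ereal) \<Rightarrow> 'a \<Rightarrow> 'a \<Rightarrow> bool" where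
  "variationally_convex \<phi> xb vb \<longleftrightarrow>
     vb \<in> limiting_subdiff \<phi> xb \<and> var_convex_gen ereal_convex_on \<phi> xb vb"

definition strongly_variationally_convex ::
    "('a::euclidean_space \<Rightarrow> ereal) \<Rightarrow> 'a \<Rightarrow> 'a \<Rightarrow> real \<Rightarrow> bool" where
  "strongly_variationally_convex \<phi> xb vb \<sigma> \<longleftrightarrow>
     vb \<in> limiting_subdiff \<phi> xb \<and> var_convex_gen (\<lambda>U. ereal_strongly_convex_on U \<sigma>) \<phi> xb vb"

definition tilt_argmin :: "('a::real_inner \<Rightarrow> ereal) \<Rightarrow> 'a \<Rightarrow> real \<Rightarrow> 'a \<Rightarrow> 'a set" where
  "tilt_argmin \<phi> xb \<gamma> v = {x \<in> cball xb \<gamma>. \<forall>z \<in> cball xb \<gamma>.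
       \<phi> x - ereal (v \<bullet> x) \<le> \<phi> z - ereal (v \<bullet> z)}"

definition tilt_stable :: "('a::real_inner \<Rightarrow> ereal) \<Rightarrow> 'a \<Rightarrow> real \<Rightarrow> bool" where
  "tilt_stable \<phi> xb \<kappa> \<longleftrightarrow> (\<exists>\<gamma>>0. \<exists>W m. open W \<and> 0 \<in> W
      \<and> (\<forall>v\<in>W. tilt_argmin \<phi> xb \<gamma> v = {m v}) \<and> \<kappa>-lipschitz_on W m
      \<and> tilt_argmin \<phi> xb \<gamma> 0 = {xb})"

end

theory Submission
  imports Defs
begin

text \<open>
  The proof goes through the Moreau envelope of \<open>\<phi> = f + \<delta>\<^sub>\<Gamma>\<close>. Under MSCQ the normals of \<open>\<Gamma>\<close> near \<open>xb\<close>
  have multipliers bounded in terms of the normal, so \<open>\<phi>\<close> is prox-regular at \<open>xb\<close> for \<open>0\<close> and, with \<open>\<mu>\<close>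
  large, the proximal map \<open>P\<close> is single-valued and Lipschitz near \<open>xb\<close> and the envelope is \<open>C\<^sup>1\<close> with
  gradient \<open>\<mu> (z - P z)\<close>. If \<open>(w, q)\<close> is a contingent direction of \<open>gph \<partial>\<phi>\<close> at \<open>(x, v)\<close>, then, since a
  polyhedron has finitely many normal cones, \<open>w\<close> lies in the critical cone and
  \<open>q \<bullet> w = \<langle>\<nabla>\<^sup>2 f(x) w, w\<rangle> + \<langle>w, \<nabla>\<^sup>2 \<langle>y, g\<rangle>(x) w\<rangle>\<close> for some multiplier \<open>y\<close>. The second-order condition
  therefore bounds the Dini derivatives of the gradient of the envelope along segments from below, which
  makes the envelope (strongly) convex, and this is equivalent to
  \<open>\<phi> u \<ge> \<phi> x + v \<bullet> (u - x) + \<sigma>/2 \<parallel>u - x\<parallel>\<^sup>2\<close> for all \<open>(x, v) \<in> gph \<partial>\<phi>\<close> near \<open>(xb, 0)\<close> and \<open>u\<close> near \<open>xb\<close>.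
  The supremum \<open>\<psi>\<close> of these minorants is the required convex function: its subgradients near \<open>(xb, 0)\<close> are
  those of \<open>\<phi>\<close> by Minty's argument, because \<open>x + v / \<mu>\<close> ranges over a neighbourhood of \<open>xb\<close>. Tilt stability
  with modulus \<open>1 / \<sigma>\<close> follows from the same inequality.
\<close>

section \<open>A mean value inequality from lower Dini derivatives\<close>

text \<open>For slope \<open>k - \<eta>\<close> the times at which the bound holds form a closed set
  \<open>D\<close>. At the infimum \<open>b\<close> of the complement the bound still holds by
  closedness, and the Dini hypothesis at \<open>b\<close> carries it past \<open>b\<close>, a
  contradiction. Letting \<open>\<eta>\<close> tend to 0 gives slope \<open>k\<close>.\<close>

lemma dini_lower_bound:
  fixes \<theta> :: "real \<Rightarrow> real"
  assumes cont: "continuous_on {0..1} \<theta>"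
    and dini: "\<And>t \<eta>. 0 \<le> t \<Longrightarrow> t < 1 \<Longrightarrow> \<eta> > 0 \<Longrightarrow>
      \<exists>\<delta>>0. \<forall>s. 0 < s \<and> s < \<delta> \<longrightarrow> \<theta> t + (k - \<eta>) * s \<le> \<theta> (t + s)"
    and t: "t \<in> {0..1}"
  shows "\<theta> 0 + k * t \<le> \<theta> t"
proof -
  have *: "\<theta> 0 + (k - \<eta>) * t \<le> \<theta> t" if \<eta>: "\<eta> > 0" for \<eta>
  proof (rule ccontr)
    assume neg: "\<not> ?thesis"
    define D where "D = {s\<in>{0..1}. \<theta> 0 + (k - \<eta>) * s \<le> \<theta> s}"
    define B where "B = {0..1} - D"
    define b where "b = Inf B"
    have "t \<in> B" using neg t by (auto simp: B_def D_def)
    have bdd: "bdd_below B" by (auto simp: B_def bdd_below_def)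
    have b: "0 \<le> b" "b \<le> t"
      unfolding b_def using \<open>t \<in> B\<close> bdd
      by (auto intro!: cInf_greatest cInf_lower simp: B_def)
    have "closed D" unfolding D_def
      by (intro continuous_on_closed_Collect_le continuous_intros cont)
    have below: "s \<in> D" if "0 \<le> s" "s < b" for s
      using that cInf_lower[OF _ bdd, of s] b t unfolding b_def B_def by fastforce
    have "b \<in> D"
    proof (cases "b = 0")
      case True then show ?thesis by (auto simp: D_def)
    next
      case False
      have "closure {0..<b} \<subseteq> D"
        using below \<open>closed D\<close> by (intro closure_minimal) auto
      then show ?thesis using b False by auto
    qed
    \<comment> \<open>The Dini hypothesis is available only to the left of 1; \<open>b = t\<close>
      is excluded because \<open>b\<close> lies in \<open>D\<close> and \<open>t\<close> does
      not.\<close>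
    have "b < 1" using \<open>b \<in> D\<close> \<open>t \<in> B\<close> b t by (cases "b = t") (auto simp: B_def)
    then obtain \<delta> where \<delta>: "\<delta> > 0"
        "\<And>s. 0 < s \<Longrightarrow> s < \<delta> \<Longrightarrow> \<theta> b + (k - \<eta>) * s \<le> \<theta> (b + s)"
      using dini[OF b(1) _ \<eta>] by blast
    have "b + \<delta> \<le> b" unfolding b_def
    proof (rule cInf_greatest)
      show "B \<noteq> {}" using \<open>t \<in> B\<close> by blast
      fix s assume s: "s \<in> B"
      then have "b \<le> s" unfolding b_def by (intro cInf_lower bdd)
      moreover have "s \<noteq> b" using s \<open>b \<in> D\<close> by (auto simp: B_def)
      moreover have False if "b < s" "s < b + \<delta>"
      proof -
        have "\<theta> b + (k - \<eta>) * (s - b) \<le> \<theta> s" using \<delta>(2)[of "s - b"] that by auto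
        moreover have "\<theta> 0 + (k - \<eta>) * b \<le> \<theta> b" using \<open>b \<in> D\<close> by (auto simp: D_def)
        ultimately have "\<theta> 0 + (k - \<eta>) * s \<le> \<theta> s" by (simp add: algebra_simps)
        then show False using s by (auto simp: B_def D_def)
      qed
      ultimately show "Inf B + \<delta> \<le> s" unfolding b_def by force
    qed
    then show False using \<delta> by simp
  qed
  show ?thesis
  proof (rule field_le_epsilon)
    fix e :: real assume "e > 0"
    have "e * t \<le> e" using t \<open>e > 0\<close> by (simp add: mult_left_le)
    then show "\<theta> 0 + k * t \<le> \<theta> t + e" using *[OF \<open>e > 0\<close>] by (simp add: algebra_simps)
  qed
qed

subsection \<open>Subgradients of constrained functions\<close>

abbreviation (input) constrained :: "('a \<Rightarrow> real) \<Rightarrow> 'a set \<Rightarrow> 'a \<Rightarrow> ereal" where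
  "constrained f S \<equiv> \<lambda>x. ereal (f x) + indicator_ext S x"

text \<open>Off \<open>S\<close> the value is infinite, so only feasible points restrict
  \<open>v\<close>, and the condition can be stated in real numbers.\<close>

lemma frechet_subdiff_constrained:
  "v \<in> frechet_subdiff (constrained f S) x \<longleftrightarrow>
     x \<in> S \<and> (\<forall>\<epsilon>>0. \<exists>\<delta>>0. \<forall>u\<in>S \<inter> ball x \<delta>. f x + (v \<bullet> (u - x) - \<epsilon> * norm (u - x)) \<le> f u)"
  (is "?l \<longleftrightarrow> _ \<and> ?r")
proof (cases "x \<in> S")
  case True
  then show ?thesis
    unfolding frechet_subdiff_def indicator_ext_def
    by (auto simp: Ball_def) metis+
next
  case False
  then show ?thesis by (auto simp: frechet_subdiff_def indicator_ext_def)
qed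

lemma frechet_subset_limiting: "frechet_subdiff \<phi> x \<subseteq> limiting_subdiff \<phi> x"
proof
  fix v assume "v \<in> frechet_subdiff \<phi> x"
  then show "v \<in> limiting_subdiff \<phi> x"
    unfolding limiting_subdiff_def
    by (intro CollectI exI[of _ "\<lambda>_. x"] exI[of _ "\<lambda>_. v"]) auto
qed

lemma proximal_imp_frechet:
  fixes S :: "'a::real_inner set"
  assumes "x \<in> S" "\<rho> > 0"
    and le: "\<And>u. u \<in> S \<inter> ball x \<rho> \<Longrightarrow> f x + v \<bullet> (u - x) - c * (norm (u - x))\<^sup>2 \<le> f u"
  shows "v \<in> frechet_subdiff (constrained f S) x"
  unfolding frechet_subdiff_constrained
proof (intro conjI allI impI)
  fix \<epsilon> :: real assume \<epsilon>: "\<epsilon> > 0"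
  \<comment> \<open>Within this radius \<open>c * norm (u - x) \<le> \<epsilon>\<close>, so the
    quadratic error is absorbed by the linear one; the \<open>+ 1\<close> covers
    \<open>c = 0\<close>.\<close>
  define \<delta> where "\<delta> = min \<rho> (\<epsilon> / (\<bar>c\<bar> + 1))"
  show "\<exists>\<delta>>0. \<forall>u\<in>S \<inter> ball x \<delta>. f x + (v \<bullet> (u - x) - \<epsilon> * norm (u - x)) \<le> f u"
  proof (intro exI[of _ \<delta>] conjI ballI)
    show "\<delta> > 0" using \<epsilon> \<open>\<rho> > 0\<close> by (auto simp: \<delta>_def)
    fix u assume u: "u \<in> S \<inter> ball x \<delta>"
    have n: "norm (u - x) < \<epsilon> / (\<bar>c\<bar> + 1)"
      using u by (auto simp: \<delta>_def dist_norm norm_minus_commute)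
    then have "(\<bar>c\<bar> + 1) * norm (u - x) \<le> \<epsilon>" by (simp add: field_simps)
    moreover have "c * norm (u - x) \<le> (\<bar>c\<bar> + 1) * norm (u - x)" by (intro mult_right_mono) auto
    ultimately have "c * norm (u - x) \<le> \<epsilon>" by linarith
    then have "c * norm (u - x) * norm (u - x) \<le> \<epsilon> * norm (u - x)"
      by (intro mult_right_mono) auto
    moreover have "u \<in> S \<inter> ball x \<rho>" using u by (auto simp: \<delta>_def)
    ultimately show "f x + (v \<bullet> (u - x) - \<epsilon> * norm (u - x)) \<le> f u"
      using le[of u] by (simp add: power2_eq_square algebra_simps)
  qed
qed (use assms in auto)

text \<open>Convexity makes the local Frechet inequality global: it is applied a small fraction
  \<open>t\<close> of the way from \<open>y\<close> to \<open>u\<close> and divided by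
  \<open>t\<close>. The global inequality survives limits of points and subgradients.\<close>

lemma convex_limiting_subdiff:
  fixes h :: "'a::euclidean_space \<Rightarrow> real"
  assumes conv: "convex_on UNIV h" and v: "v \<in> limiting_subdiff (\<lambda>u. ereal (h u)) x"
  shows "h x + v \<bullet> (u - x) \<le> h u"
proof -
  have frechet: "h y + v' \<bullet> (u - y) \<le> h u" if v': "v' \<in> frechet_subdiff (\<lambda>u. ereal (h u)) y" for y v'
  proof (rule field_le_epsilon)
    fix e :: real assume "e > 0"
    define X where "X = norm (u - y) + 1"
    have X: "X > 0" "norm (u - y) \<le> X" by (simp_all add: X_def add_nonneg_pos)
    define \<epsilon> where "\<epsilon> = e / X"
    have "\<epsilon> > 0" using \<open>e > 0\<close> X by (simp add: \<epsilon>_def)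
    then obtain \<delta> where \<delta>: "\<delta> > 0"
      "\<And>w. w \<in> ball y \<delta> \<Longrightarrow> h y + (v' \<bullet> (w - y) - \<epsilon> * norm (w - y)) \<le> h w"
      using v' unfolding frechet_subdiff_def by auto
    define t where "t = min 1 (\<delta> / (2 * X))"
    have t: "0 < t" "t \<le> 1" using \<delta>(1) X by (auto simp: t_def)
    have "t * norm (u - y) \<le> \<delta> / (2 * X) * X"
      using \<delta>(1) t X by (intro mult_mono) (auto simp: t_def)
    also have "\<dots> < \<delta>" using X \<delta>(1) by simp
    finally have "t * norm (u - y) < \<delta>" .
    then have "y + t *\<^sub>R (u - y) \<in> ball y \<delta>" using t by (simp add: dist_norm)
    from \<delta>(2)[OF this] have "h y + (t * (v' \<bullet> (u - y)) - \<epsilon> * (t * norm (u - y))) \<le> h (y + t *\<^sub>R (u - y))"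
      using t by simp
    also have "y + t *\<^sub>R (u - y) = (1 - t) *\<^sub>R y + t *\<^sub>R u" by (simp add: algebra_simps)
    also have "h \<dots> \<le> (1 - t) * h y + t * h u"
      using convex_onD[OF conv, of t y u] t by simp
    finally have "t * (h y + v' \<bullet> (u - y)) \<le> t * (h u + \<epsilon> * norm (u - y))"
      by (simp add: algebra_simps)
    then have "h y + v' \<bullet> (u - y) \<le> h u + \<epsilon> * norm (u - y)" using t by simp
    also have "\<epsilon> * norm (u - y) \<le> \<epsilon> * X" using \<open>\<epsilon> > 0\<close> X by simp
    also have "\<dots> = e" using X by (simp add: \<epsilon>_def)
    finally show "h y + v' \<bullet> (u - y) \<le> h u + e" by simp
  qed
  from v obtain xs vs where lim: "xs \<longlonglongrightarrow> x" "(\<lambda>k. h (xs k)) \<longlonglongrightarrow> h x" "vs \<longlonglongrightarrow> v"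
    and F: "\<And>k. vs k \<in> frechet_subdiff (\<lambda>u. ereal (h u)) (xs k)"
    unfolding limiting_subdiff_def by auto
  have "(\<lambda>k. h (xs k) + vs k \<bullet> (u - xs k)) \<longlonglongrightarrow> h x + v \<bullet> (u - x)"
    by (intro tendsto_intros lim)
  then show ?thesis by (rule LIMSEQ_le_const2) (use frechet[OF F] in auto)
qed

lemma subgradient_imp_frechet:
  assumes "\<And>u. h x + v \<bullet> (u - x) \<le> h u"
  shows "v \<in> frechet_subdiff (\<lambda>u. ereal (h u)) x"
  unfolding frechet_subdiff_def
proof (intro CollectI conjI allI impI)
  fix \<epsilon> :: real assume "\<epsilon> > 0"
  have "h x + (v \<bullet> (u - x) - \<epsilon> * norm (u - x)) \<le> h u" for u
  proof -
    have "0 \<le> \<epsilon> * norm (u - x)" using \<open>\<epsilon> > 0\<close> by simp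
    then show ?thesis using assms[of u] by linarith
  qed
  then show "\<exists>\<delta>>0. \<forall>u\<in>ball x \<delta>. ereal (h x) + ereal (v \<bullet> (u - x) - \<epsilon> * norm (u - x)) \<le> ereal (h u)"
    by (intro exI[of _ 1]) auto
qed simp

text \<open>\<open>xb\<close> is a competitor of finite value, so a minimizer is feasible and the
  comparison reduces to feasible points.\<close>

lemma tilt_argmin_constrained:
  assumes "xb \<in> S" "\<gamma> \<ge> 0"
  shows "x \<in> tilt_argmin (constrained f S) xb \<gamma> v \<longleftrightarrow>
    x \<in> S \<inter> cball xb \<gamma> \<and> (\<forall>z\<in>S \<inter> cball xb \<gamma>. f x - v \<bullet> x \<le> f z - v \<bullet> z)"
proof
  assume x: "x \<in> tilt_argmin (constrained f S) xb \<gamma> v"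
  have le: "constrained f S x - ereal (v \<bullet> x) \<le> constrained f S z - ereal (v \<bullet> z)" if "z \<in> cball xb \<gamma>" for z
    using x that by (auto simp: tilt_argmin_def)
  have "x \<in> S"
    using le[of xb] assms by (cases "x \<in> S") (auto simp: indicator_ext_def)
  moreover have "f x - v \<bullet> x \<le> f z - v \<bullet> z" if "z \<in> S \<inter> cball xb \<gamma>" for z
    using le[of z] that \<open>x \<in> S\<close> by (auto simp: indicator_ext_def)
  ultimately show "x \<in> S \<inter> cball xb \<gamma> \<and> (\<forall>z\<in>S \<inter> cball xb \<gamma>. f x - v \<bullet> x \<le> f z - v \<bullet> z)"
    using x by (auto simp: tilt_argmin_def)
next
  assume "x \<in> S \<inter> cball xb \<gamma> \<and> (\<forall>z\<in>S \<inter> cball xb \<gamma>. f x - v \<bullet> x \<le> f z - v \<bullet> z)"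
  then show "x \<in> tilt_argmin (constrained f S) xb \<gamma> v"
    by (auto simp: tilt_argmin_def indicator_ext_def)
qed

subsection \<open>The Moreau envelope of a prox-regular function\<close>

text \<open>The completed square behind the infimal convolution of two quadratics;
  \<open>modulus_bound\<close> rests on it.\<close>

lemma weighted_norm_sq_diff:
  fixes w p :: "'a::real_inner"
  shows "(norm (a *\<^sub>R w - b *\<^sub>R p))\<^sup>2 = (b + a) * (a * (norm w)\<^sup>2 + b * (norm p)\<^sup>2) - b * a * (norm (w + p))\<^sup>2"
  by (simp add: power2_norm_eq_inner algebra_simps inner_commute)

text \<open>The abstract setting of the envelope argument, free of the constraint system.
  \<open>prox\<close> is prox-regularity with uniform constants; \<open>contingent\<close> is strong
  monotonicity in infinitesimal form, for contingent directions \<open>(w, q)\<close> of the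
  subdifferential graph. The value \<open>\<sigma> = 0\<close> is allowed, so that convexity and
  strong convexity are treated together.\<close>

locale prox_regular_constrained =
  fixes f :: "'a::euclidean_space \<Rightarrow> real" and S :: "'a set" and xb :: 'a and R r \<sigma> :: real
  assumes R_pos: "R > 0" and r_pos: "r > 0" and sigma_nonneg: "\<sigma> \<ge> 0"
    and compact: "compact (S \<inter> cball xb R)"
    and cont: "continuous_on (S \<inter> cball xb R) f"
    and base: "0 \<in> limiting_subdiff (constrained f S) xb"
    and prox: "\<And>x v u. v \<in> limiting_subdiff (constrained f S) x \<Longrightarrow> norm (x - xb) < R \<Longrightarrow> norm v < R
      \<Longrightarrow> u \<in> S \<Longrightarrow> norm (u - xb) \<le> R \<Longrightarrow> f x + v \<bullet> (u - x) - r * (norm (u - x))\<^sup>2 \<le> f u"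
    and contingent: "\<And>x v xs vs s w q.
      v \<in> limiting_subdiff (constrained f S) x \<Longrightarrow> norm (x - xb) < R \<Longrightarrow> norm v < R
      \<Longrightarrow> (\<And>k::nat. vs k \<in> limiting_subdiff (constrained f S) (xs k))
      \<Longrightarrow> (\<And>k. norm (xs k - xb) < R) \<Longrightarrow> (\<And>k. norm (vs k) < R)
      \<Longrightarrow> (\<And>k. s k > 0) \<Longrightarrow> s \<longlonglongrightarrow> 0
      \<Longrightarrow> (\<lambda>k. (xs k - x) /\<^sub>R s k) \<longlonglongrightarrow> w \<Longrightarrow> (\<lambda>k. (vs k - v) /\<^sub>R s k) \<longlonglongrightarrow> q
      \<Longrightarrow> q \<bullet> w \<ge> \<sigma> * (norm w)\<^sup>2"
begin

section \<open>The localized graph of the subdifferential\<close>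

definition G :: "('a \<times> 'a) set" where
  "G = {(x, v). v \<in> limiting_subdiff (constrained f S) x \<and> norm (x - xb) < R \<and> norm v < R}"

text \<open>The definition of \<open>limiting_subdiff\<close> does not ask for a finite value at
  \<open>x\<close>. Feasibility comes from the approximating points, which lie in \<open>S\<close>
  and eventually in the compact set \<open>S \<inter> cball xb R\<close>.\<close>

lemma G_feasible: "x \<in> S" if "(x, v) \<in> G"
proof -
  from that obtain xs vs where xs: "xs \<longlonglongrightarrow> x"
      "\<And>k::nat. vs k \<in> frechet_subdiff (constrained f S) (xs k)" and x: "norm (x - xb) < R"
    unfolding G_def limiting_subdiff_def by auto
  have "\<forall>\<^sub>F k in sequentially. xs k \<in> ball xb R"
    using topological_tendstoD[OF xs(1), of "ball xb R"] x
    by (simp add: dist_norm norm_minus_commute)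
  then have "\<forall>\<^sub>F k in sequentially. xs k \<in> S \<inter> cball xb R"
    by eventually_elim (use xs(2) in \<open>auto simp: frechet_subdiff_constrained\<close>)
  with compact_imp_closed[OF compact] have "x \<in> S \<inter> cball xb R"
    by (rule Lim_in_closed_set[OF _ _ trivial_limit_sequentially xs(1)])
  then show ?thesis by simp
qed

lemma base_G: "(xb, 0) \<in> G"
  using base R_pos by (simp add: G_def)

lemma xb_in_S: "xb \<in> S"
  using G_feasible[OF base_G] .

lemma prox_G: "(x, v) \<in> G \<Longrightarrow> u \<in> S \<Longrightarrow> norm (u - xb) \<le> R
    \<Longrightarrow> f x + v \<bullet> (u - x) - r * (norm (u - x))\<^sup>2 \<le> f u"
  using prox by (auto simp: G_def)

text \<open>Pairs found by minimization enter \<open>G\<close> this way: a quadratic lower bound on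
  the \<open>R\<close>-ball makes \<open>v\<close> a Frechet subgradient at a point strictly inside
  it.\<close>

lemma stationary_G:
  assumes "x \<in> S" "norm (x - xb) < R" "norm v < R"
    and le: "\<And>u. u \<in> S \<Longrightarrow> norm (u - xb) \<le> R \<Longrightarrow> f x + v \<bullet> (u - x) - c * (norm (u - x))\<^sup>2 \<le> f u"
  shows "(x, v) \<in> G"
proof -
  have "v \<in> frechet_subdiff (constrained f S) x"
  proof (rule proximal_imp_frechet)
    show "R - norm (x - xb) > 0" using assms by simp
    fix u assume u: "u \<in> S \<inter> ball x (R - norm (x - xb))"
    then have "norm (u - xb) \<le> R"
      using norm_triangle_ineq[of "u - x" "x - xb"] by (auto simp: dist_norm norm_minus_commute)
    then show "f x + v \<bullet> (u - x) - c * (norm (u - x))\<^sup>2 \<le> f u" using le u by auto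
  qed fact
  then show ?thesis using frechet_subset_limiting assms by (auto simp: G_def)
qed

section \<open>The localized proximal map\<close>

text \<open>The factor 8 gives the distance factor \<open>sqrt 3\<close> in
  \<open>is_prox_near\<close> and the Lipschitz constant 4/3 in \<open>is_prox_lipschitz\<close>;
  both are rounded up to 2.\<close>

definition \<mu> :: real where "\<mu> = 8 * r"

lemma mu_pos: "\<mu> > 0" using r_pos by (simp add: \<mu>_def)

text \<open>Minimizing over a compact piece of \<open>S\<close> guarantees existence and relies on
  local information about \<open>f\<close> alone.\<close>

definition is_prox :: "'a \<Rightarrow> 'a \<Rightarrow> bool" where
  "is_prox z x \<longleftrightarrow> x \<in> S \<inter> cball xb R \<and>
     (\<forall>u\<in>S \<inter> cball xb R. f x + \<mu>/2 * (norm (x - z))\<^sup>2 \<le> f u + \<mu>/2 * (norm (u - z))\<^sup>2)"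

lemma dist_xb: "dist xb u = norm (u - xb)"
  by (simp add: dist_norm norm_minus_commute)

lemma norm_sq_diff: "(norm (u - z))\<^sup>2 = (norm (u - x))\<^sup>2 + 2 * ((u - x) \<bullet> (x - z)) + (norm (x - z))\<^sup>2"
  for u z x :: 'a
  unfolding power2_norm_eq_inner by (simp add: algebra_simps inner_commute)

lemma is_prox_exists: "\<exists>x. is_prox z x"
proof -
  have "continuous_on (S \<inter> cball xb R) (\<lambda>x. f x + \<mu>/2 * (norm (x - z))\<^sup>2)"
    by (intro continuous_intros cont)
  moreover have "S \<inter> cball xb R \<noteq> {}" using xb_in_S R_pos by force
  ultimately show ?thesis
    using continuous_attains_inf[OF compact] unfolding is_prox_def by blast
qed

text \<open>\<open>R / 3\<close> keeps the proximal point within \<open>R\<close> of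
  \<open>xb\<close>, by \<open>is_prox_near_xb\<close>; \<open>R / (2 * \<mu>)\<close> keeps its
  subgradient \<open>\<mu> *\<^sub>R (z - x)\<close> shorter than \<open>R\<close>, by
  \<open>is_prox_near\<close>.\<close>

definition \<rho> :: real where "\<rho> = min (R / 3) (R / (2 * \<mu>))"

lemma rho_pos: "\<rho> > 0" using R_pos mu_pos by (auto simp: \<rho>_def)

text \<open>\<open>x\<close> is compared with the competitor \<open>xb\<close>, while
  \<open>prox\<close> at \<open>(xb, 0)\<close> limits how far \<open>f x\<close> can drop below
  \<open>f xb\<close>.\<close>

lemma is_prox_near:
  assumes "is_prox z x"
  shows "norm (x - z) \<le> 2 * norm (z - xb)"
proof -
  have x: "x \<in> S" "norm (x - xb) \<le> R" using assms by (auto simp: is_prox_def dist_xb)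
  have "f xb - r * (norm (x - xb))\<^sup>2 \<le> f x" using prox_G[OF base_G x] by simp
  moreover have "f x + 4 * r * (norm (x - z))\<^sup>2 \<le> f xb + 4 * r * (norm (z - xb))\<^sup>2"
    using assms xb_in_S R_pos by (auto simp: is_prox_def \<mu>_def norm_minus_commute)
  moreover have "(norm (x - xb))\<^sup>2 \<le> 2 * (norm (x - z))\<^sup>2 + 2 * (norm (z - xb))\<^sup>2"
  proof -
    have "(norm (x - xb))\<^sup>2 \<le> (norm (x - z) + norm (z - xb))\<^sup>2"
      using norm_triangle_ineq[of "x - z" "z - xb"] by (intro power_mono) auto
    also have "\<dots> \<le> 2 * (norm (x - z))\<^sup>2 + 2 * (norm (z - xb))\<^sup>2"
      using sum_squares_bound[of "norm (x - z)" "norm (z - xb)"] by (simp add: power2_sum)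
    finally show ?thesis .
  qed
  then have "r * (norm (x - xb))\<^sup>2 \<le> r * (2 * (norm (x - z))\<^sup>2 + 2 * (norm (z - xb))\<^sup>2)"
    using r_pos by (intro mult_left_mono) auto
  ultimately have "r * (norm (x - z))\<^sup>2 * 2 \<le> r * (3 * (norm (z - xb))\<^sup>2) * 2"
    by (simp add: algebra_simps)
  then have "(norm (x - z))\<^sup>2 \<le> 3 * (norm (z - xb))\<^sup>2" using r_pos by simp
  also have "\<dots> \<le> (2 * norm (z - xb))\<^sup>2" by (simp add: power_mult_distrib)
  finally show ?thesis by (rule power2_le_imp_le) simp
qed

lemma is_prox_near_xb: "is_prox z x \<Longrightarrow> norm (x - xb) \<le> 3 * norm (z - xb)"
  using is_prox_near[of z x] norm_triangle_ineq[of "x - z" "z - xb"] by simp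

text \<open>Expanding the square around \<open>x\<close> turns minimality into a quadratic lower
  bound with slope \<open>\<mu> *\<^sub>R (z - x)\<close>, the form that \<open>stationary_G\<close>
  asks for.\<close>

lemma is_prox_G:
  assumes "is_prox z x" "norm (z - xb) < \<rho>"
  shows "(x, \<mu> *\<^sub>R (z - x)) \<in> G"
proof (rule stationary_G)
  show "x \<in> S" using assms by (simp add: is_prox_def)
  show "norm (x - xb) < R" using is_prox_near_xb[OF assms(1)] assms(2) by (simp add: \<rho>_def)
  have "\<mu> * norm (x - z) \<le> \<mu> * (2 * norm (z - xb))"
    using is_prox_near[OF assms(1)] mu_pos by simp
  also have "\<dots> < R" using assms(2) mu_pos by (simp add: \<rho>_def field_simps)
  finally show "norm (\<mu> *\<^sub>R (z - x)) < R" using mu_pos by (simp add: norm_minus_commute)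
  fix u assume "u \<in> S" "norm (u - xb) \<le> R"
  then have "f x + \<mu>/2 * (norm (x - z))\<^sup>2 \<le> f u + \<mu>/2 * (norm (u - z))\<^sup>2"
    using assms(1) by (auto simp: is_prox_def dist_xb)
  then show "f x + (\<mu> *\<^sub>R (z - x)) \<bullet> (u - x) - \<mu>/2 * (norm (u - x))\<^sup>2 \<le> f u"
    unfolding norm_sq_diff[of u z x] by (simp add: algebra_simps inner_commute)
qed

lemma G_strict_prox:
  assumes "(x, v) \<in> G" "u \<in> S" "norm (u - xb) \<le> R"
  shows "f x + \<mu>/2 * (norm (v /\<^sub>R \<mu>))\<^sup>2 + (\<mu>/2 - r) * (norm (u - x))\<^sup>2
           \<le> f u + \<mu>/2 * (norm (u - (x + v /\<^sub>R \<mu>)))\<^sup>2"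
proof -
  have "\<mu>/2 * (norm (u - (x + v /\<^sub>R \<mu>)))\<^sup>2
      = \<mu>/2 * (norm (u - x))\<^sup>2 - v \<bullet> (u - x) + \<mu>/2 * (norm (v /\<^sub>R \<mu>))\<^sup>2"
    unfolding norm_sq_diff[of u "x + v /\<^sub>R \<mu>" x] using mu_pos
    by (simp add: field_simps inner_commute)
  then show ?thesis using prox_G[OF assms] by (simp add: algebra_simps)
qed

text \<open>The Minty parametrization: near \<open>xb\<close> the proximal map inverts the passage
  from \<open>(x, v)\<close> in \<open>G\<close> to \<open>x + v /\<^sub>R \<mu>\<close>, because
  \<open>\<mu> / 2\<close> outweighs the prox-regularity defect \<open>r\<close>.\<close>

lemma G_is_prox:
  assumes "(x, v) \<in> G"
  shows "is_prox (x + v /\<^sub>R \<mu>) x"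
  unfolding is_prox_def
proof (intro conjI ballI)
  show "x \<in> S \<inter> cball xb R" using G_feasible[OF assms] assms by (auto simp: G_def dist_xb)
  fix u assume "u \<in> S \<inter> cball xb R"
  then have u: "u \<in> S" "norm (u - xb) \<le> R" by (auto simp: dist_xb)
  have "(\<mu>/2 - r) * (norm (u - x))\<^sup>2 \<ge> 0" using r_pos by (simp add: \<mu>_def)
  then show "f x + \<mu>/2 * (norm (x - (x + v /\<^sub>R \<mu>)))\<^sup>2 \<le> f u + \<mu>/2 * (norm (u - (x + v /\<^sub>R \<mu>)))\<^sup>2"
    using G_strict_prox[OF assms u] by (simp add: norm_minus_commute)
qed

text \<open>The \<open>prox\<close> inequalities of the two pairs, each tested at the other point,
  are added.\<close>

lemma G_hypomonotone:
  assumes "(x, v) \<in> G" "(x', v') \<in> G"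
  shows "(v - v') \<bullet> (x - x') \<ge> - 2 * r * (norm (x - x'))\<^sup>2"
proof -
  have "f x + v \<bullet> (x' - x) - r * (norm (x' - x))\<^sup>2 \<le> f x'"
    by (rule prox_G[OF assms(1) G_feasible[OF assms(2)]]) (use assms(2) in \<open>simp add: G_def\<close>)
  moreover have "f x' + v' \<bullet> (x - x') - r * (norm (x - x'))\<^sup>2 \<le> f x"
    by (rule prox_G[OF assms(2) G_feasible[OF assms(1)]]) (use assms(1) in \<open>simp add: G_def\<close>)
  ultimately show ?thesis
    by (simp add: algebra_simps norm_minus_commute)
qed

text \<open>Hypomonotonicity of the pairs \<open>(x, \<mu> *\<^sub>R (z - x))\<close> gives
  \<open>(\<mu> - 2 * r) * (norm (x - x'))\<^sup>2 \<le> \<mu> * ((z - z') \<bullet> (x -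
  x'))\<close>; Cauchy-Schwarz does the rest.\<close>

lemma is_prox_lipschitz:
  assumes "is_prox z x" "norm (z - xb) < \<rho>" "is_prox z' x'" "norm (z' - xb) < \<rho>"
  shows "norm (x - x') \<le> 2 * norm (z - z')"
proof -
  have "(\<mu> *\<^sub>R (z - x) - \<mu> *\<^sub>R (z' - x')) \<bullet> (x - x') \<ge> - 2 * r * (norm (x - x'))\<^sup>2"
    by (intro G_hypomonotone is_prox_G assms)
  then have "\<mu> * ((z - z') \<bullet> (x - x')) - \<mu> * (norm (x - x'))\<^sup>2 \<ge> - 2 * r * (norm (x - x'))\<^sup>2"
    unfolding power2_norm_eq_inner by (simp add: algebra_simps)
  then have "r * (3 * (norm (x - x'))\<^sup>2) * 2 \<le> r * (4 * ((z - z') \<bullet> (x - x'))) * 2"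
    by (simp add: \<mu>_def algebra_simps)
  then have "3 * (norm (x - x'))\<^sup>2 \<le> 4 * ((z - z') \<bullet> (x - x'))" using r_pos by simp
  also have "\<dots> \<le> 4 * (norm (z - z') * norm (x - x'))"
    using norm_cauchy_schwarz[of "z - z'" "x - x'"] by simp
  finally have le: "3 * (norm (x - x') * norm (x - x')) \<le> 4 * (norm (z - z') * norm (x - x'))"
    by (simp add: power2_eq_square)
  show ?thesis
  proof (cases "norm (x - x') = 0")
    case False
    then have "norm (x - x') > 0" by simp
    have "(3 * norm (x - x')) * norm (x - x') \<le> (4 * norm (z - z')) * norm (x - x')"
      using le by simp
    then have "3 * norm (x - x') \<le> 4 * norm (z - z')"
      using \<open>norm (x - x') > 0\<close> by (rule mult_right_le_imp_le)
    then show ?thesis using norm_ge_zero[of "z - z'"] by linarith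
  qed simp
qed

text \<open>A choice: minimizers exist for every \<open>z\<close>, but uniqueness is established
  only within \<open>\<rho>\<close> of \<open>xb\<close>, in \<open>P_eqI\<close>.\<close>

definition P :: "'a \<Rightarrow> 'a" where "P z = (SOME x. is_prox z x)"

lemma is_prox_P: "is_prox z (P z)"
  unfolding P_def by (rule someI_ex[OF is_prox_exists])

lemma P_lipschitz: "norm (z - xb) < \<rho> \<Longrightarrow> norm (z' - xb) < \<rho> \<Longrightarrow> norm (P z - P z') \<le> 2 * norm (z - z')"
  by (intro is_prox_lipschitz is_prox_P)

lemma P_eqI: "is_prox z x \<Longrightarrow> norm (z - xb) < \<rho> \<Longrightarrow> P z = x"
  using is_prox_lipschitz[OF is_prox_P[of z], of z x] by simp

text \<open>Near \<open>xb\<close> this is the gradient of the envelope as well as the subgradient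
  of the constrained function attached to the proximal point.\<close>

definition dual_P :: "'a \<Rightarrow> 'a" where "dual_P z = \<mu> *\<^sub>R (z - P z)"

lemma P_G: "norm (z - xb) < \<rho> \<Longrightarrow> (P z, dual_P z) \<in> G"
  unfolding dual_P_def by (intro is_prox_G is_prox_P)

section \<open>The envelope, its gradient and its convexity\<close>

definition envelope :: "'a \<Rightarrow> real" where
  "envelope z = f (P z) + \<mu>/2 * (norm (P z - z))\<^sup>2"

lemma envelope_le: "u \<in> S \<Longrightarrow> norm (u - xb) \<le> R \<Longrightarrow> envelope z \<le> f u + \<mu>/2 * (norm (u - z))\<^sup>2"
  using is_prox_P[of z] by (auto simp: is_prox_def envelope_def dist_xb)

text \<open>\<open>P z\<close> competes in the problem that defines the envelope at
  \<open>z'\<close>. This is the upper half of differentiability; the lower half comes from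
  exchanging \<open>z\<close> and \<open>z'\<close> and the Lipschitz property of
  \<open>dual_P\<close>.\<close>

lemma envelope_upper: "envelope z' \<le> envelope z + dual_P z \<bullet> (z' - z) + \<mu>/2 * (norm (z' - z))\<^sup>2"
proof -
  have "P z \<in> S" "norm (P z - xb) \<le> R" using is_prox_P[of z] by (auto simp: is_prox_def dist_xb)
  from envelope_le[OF this, of z'] show ?thesis
    unfolding norm_sq_diff[of "P z" z' z] dual_P_def
    by (simp add: envelope_def algebra_simps inner_commute norm_minus_commute)
qed

text \<open>The modulus of the infimal convolution of two quadratics with moduli
  \<open>\<sigma>\<close> and \<open>\<mu>\<close>, hence the one to expect from the envelope of a
  \<open>\<sigma>\<close>-strongly convex function.\<close>

definition modulus :: real where "modulus = \<mu> * \<sigma> / (\<mu> + \<sigma>)"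

text \<open>For fixed \<open>d\<close> the right side is smallest where
  \<open>\<sigma> *\<^sub>R w = \<mu> *\<^sub>R (d - w)\<close>; the difference of the sides is a
  square divided by \<open>\<mu> + \<sigma>\<close>.\<close>

lemma modulus_bound:
  fixes d w :: 'a
  shows
  "modulus * (norm d)\<^sup>2 \<le> \<sigma> * (norm w)\<^sup>2 + \<mu> * (norm (d - w))\<^sup>2"
proof -
  have "0 \<le> (norm (\<sigma> *\<^sub>R w - \<mu> *\<^sub>R (d - w)))\<^sup>2" by simp
  also note weighted_norm_sq_diff[of \<sigma> w \<mu> "d - w"]
  finally have "\<mu> * \<sigma> * (norm d)\<^sup>2 \<le> (\<sigma> * (norm w)\<^sup>2 + \<mu> * (norm (d - w))\<^sup>2) * (\<mu> + \<sigma>)"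
    by (simp add: mult.commute)
  then show ?thesis
    using mu_pos sigma_nonneg by (simp add: modulus_def pos_divide_le_eq add_pos_nonneg)
qed

text \<open>The inner product of the increments of \<open>P\<close> and \<open>dual_P\<close> is controlled by \<open>contingent\<close>;
  adding \<open>(norm q)\<^sup>2 / \<mu>\<close> turns this into a bound for the increment of \<open>dual_P\<close> in the
  direction \<open>d = w + q /\<^sub>R \<mu>\<close> itself.\<close>

lemma dual_P_dini:
  assumes z: "norm (z - xb) < \<rho>" and \<eta>: "\<eta> > 0"
  shows "\<exists>\<delta>>0. \<forall>s. 0 < s \<and> s < \<delta> \<longrightarrow>
           dual_P z \<bullet> d + (modulus * (norm d)\<^sup>2 - \<eta>) * s \<le> dual_P (z + s *\<^sub>R d) \<bullet> d"
proof (rule ccontr)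
  assume "\<not> ?thesis"
  then have neg: "\<exists>s. 0 < s \<and> s < \<delta> \<and>
      dual_P (z + s *\<^sub>R d) \<bullet> d < dual_P z \<bullet> d + (modulus * (norm d)\<^sup>2 - \<eta>) * s" if "\<delta> > 0" for \<delta>
    using that by (meson not_le)
  \<comment> \<open>Steps shorter than this keep \<open>z + s *\<^sub>R d\<close> within
    \<open>\<rho>\<close> of \<open>xb\<close>.\<close>
  define \<delta>0 where "\<delta>0 = (\<rho> - norm (z - xb)) / (norm d + 1)"
  have "\<delta>0 > 0" using z by (simp add: \<delta>0_def add_nonneg_pos)
  have near: "norm (z + s *\<^sub>R d - xb) < \<rho>" if "0 < s" "s < \<delta>0" for s
  proof -
    have "norm (z + s *\<^sub>R d - xb) \<le> norm (z - xb) + s * norm d"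
      using norm_triangle_ineq[of "z - xb" "s *\<^sub>R d"] that by (simp add: algebra_simps)
    also have "s * norm d \<le> s * (norm d + 1)" using that by simp
    also have "s * (norm d + 1) < \<rho> - norm (z - xb)"
      using that by (simp add: \<delta>0_def pos_less_divide_eq add_nonneg_pos)
    finally show ?thesis by simp
  qed
  define a where "a n = min \<delta>0 (1 / real (Suc n))" for n
  have a: "a n > 0" for n using \<open>\<delta>0 > 0\<close> by (simp add: a_def)
  have "\<exists>s. \<forall>n. 0 < s n \<and> s n < a n \<and>
      dual_P (z + s n *\<^sub>R d) \<bullet> d < dual_P z \<bullet> d + (modulus * (norm d)\<^sup>2 - \<eta>) * s n"
    by (rule choice) (use neg[OF a] in blast)
  then obtain s where s: "\<And>n. 0 < s n" "\<And>n. s n < a n"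
    "\<And>n. dual_P (z + s n *\<^sub>R d) \<bullet> d < dual_P z \<bullet> d + (modulus * (norm d)\<^sup>2 - \<eta>) * s n"
    by blast
  have s0: "s \<longlonglongrightarrow> 0"
  proof (rule tendsto_sandwich[OF _ _ tendsto_const LIMSEQ_inverse_real_of_nat])
    show "\<forall>\<^sub>F n in sequentially. s n \<le> inverse (real (Suc n))"
      using s(2) by (auto intro!: always_eventually simp: a_def divide_simps less_imp_le)
  qed (use s(1) in \<open>auto intro!: always_eventually less_imp_le\<close>)
  have s\<rho>: "norm (z + s n *\<^sub>R d - xb) < \<rho>" for n
    using near s(1,2) by (simp add: a_def)
  \<comment> \<open>The quotients of \<open>P\<close> are bounded by its Lipschitz property, so a
    subsequence converges to some \<open>l\<close>; those of \<open>dual_P\<close> then converge to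
    \<open>\<mu> *\<^sub>R (d - l)\<close>, and \<open>(l, q)\<close> is a contingent
    direction.\<close>
  define w where "w n = (P (z + s n *\<^sub>R d) - P z) /\<^sub>R s n" for n
  have "norm (w n) \<le> 2 * norm d" for n
  proof -
    have "norm (P (z + s n *\<^sub>R d) - P z) \<le> 2 * (s n * norm d)"
      using P_lipschitz[OF s\<rho>[of n] z] s(1)[of n] by simp
    then have "norm (P (z + s n *\<^sub>R d) - P z) / s n \<le> 2 * norm d"
      using s(1)[of n] by (simp add: pos_divide_le_eq mult_ac)
    then show ?thesis using s(1)[of n] by (simp add: w_def divide_inverse mult.commute)
  qed
  then have "bounded (range w)" by (auto simp: bounded_iff)
  then obtain l \<tau> where \<tau>: "strict_mono \<tau>" and l: "(w \<circ> \<tau>) \<longlonglongrightarrow> l"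
    using bounded_imp_convergent_subsequence by metis
  define q where "q = \<mu> *\<^sub>R (d - l)"
  have dq: "(dual_P (z + s n *\<^sub>R d) - dual_P z) /\<^sub>R s n = \<mu> *\<^sub>R (d - w n)" for n
    unfolding dual_P_def w_def using s(1)[of n]
    by (simp add: algebra_simps)
  have lq: "(\<lambda>n. (dual_P (z + s (\<tau> n) *\<^sub>R d) - dual_P z) /\<^sub>R s (\<tau> n)) \<longlonglongrightarrow> q"
    unfolding dq q_def by (intro tendsto_intros l[unfolded o_def])
  have "q \<bullet> l \<ge> \<sigma> * (norm l)\<^sup>2"
  proof (rule contingent)
    show "dual_P z \<in> limiting_subdiff (constrained f S) (P z)" "norm (P z - xb) < R"
      "norm (dual_P z) < R" using P_G[OF z] by (auto simp: G_def)
    show "dual_P (z + s (\<tau> n) *\<^sub>R d) \<in> limiting_subdiff (constrained f S) (P (z + s (\<tau> n) *\<^sub>R d))"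
      "norm (P (z + s (\<tau> n) *\<^sub>R d) - xb) < R" "norm (dual_P (z + s (\<tau> n) *\<^sub>R d)) < R" for n
      using P_G[OF s\<rho>[of "\<tau> n"]] by (auto simp: G_def)
    show "(\<lambda>n. s (\<tau> n)) \<longlonglongrightarrow> 0" using LIMSEQ_subseq_LIMSEQ[OF s0 \<tau>] by (simp add: o_def)
    show "(\<lambda>n. (P (z + s (\<tau> n) *\<^sub>R d) - P z) /\<^sub>R s (\<tau> n)) \<longlonglongrightarrow> l"
      using l by (simp add: o_def w_def)
  qed (use s(1) lq in auto)
  moreover have "q \<bullet> d = q \<bullet> l + \<mu> * (norm (d - l))\<^sup>2"
    unfolding q_def power2_norm_eq_inner by (simp add: algebra_simps inner_commute)
  ultimately have "modulus * (norm d)\<^sup>2 \<le> q \<bullet> d" using modulus_bound[of d l] by simp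
  moreover have "q \<bullet> d \<le> modulus * (norm d)\<^sup>2 - \<eta>"
  proof (rule LIMSEQ_le_const2)
    show "(\<lambda>n. ((dual_P (z + s (\<tau> n) *\<^sub>R d) - dual_P z) /\<^sub>R s (\<tau> n)) \<bullet> d) \<longlonglongrightarrow> q \<bullet> d"
      by (intro tendsto_intros lq)
    have "((dual_P (z + s n *\<^sub>R d) - dual_P z) /\<^sub>R s n) \<bullet> d \<le> modulus * (norm d)\<^sup>2 - \<eta>" for n
    proof -
      have "((dual_P (z + s n *\<^sub>R d) - dual_P z) \<bullet> d) / s n \<le> modulus * (norm d)\<^sup>2 - \<eta>"
        using s(3)[of n] s(1)[of n] by (simp add: pos_divide_le_eq inner_diff_left)
      then show ?thesis by (simp add: divide_inverse mult.commute)
    qed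
    then show "\<exists>N. \<forall>n\<ge>N. ((dual_P (z + s (\<tau> n) *\<^sub>R d) - dual_P z) /\<^sub>R s (\<tau> n)) \<bullet> d \<le> modulus * (norm d)\<^sup>2 - \<eta>"
      by blast
  qed
  ultimately show False using \<eta> by simp
qed

lemma dual_P_lipschitz:
  assumes "norm (z - xb) < \<rho>" "norm (z' - xb) < \<rho>"
  shows "norm (dual_P z - dual_P z') \<le> 3 * \<mu> * norm (z - z')"
proof -
  have "dual_P z - dual_P z' = \<mu> *\<^sub>R ((z - z') - (P z - P z'))"
    by (simp add: dual_P_def algebra_simps)
  then have "norm (dual_P z - dual_P z') = \<mu> * norm ((z - z') - (P z - P z'))"
    using mu_pos by simp
  also have "\<dots> \<le> \<mu> * (3 * norm (z - z'))"
    using norm_triangle_ineq4[of "z - z'" "P z - P z'"] P_lipschitz[OF assms] mu_pos by auto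
  finally show ?thesis by simp
qed

text \<open>On the segment from \<open>z\<close> to \<open>z'\<close> the envelope has derivative
  \<open>\<theta>\<close>. The Dini bound on \<open>dual_P\<close> makes \<open>\<theta>\<close>
  grow at least at rate \<open>k\<close>, and integrating this gives the quadratic term.\<close>

lemma envelope_convex:
  assumes z: "norm (z - xb) < \<rho>" and z': "norm (z' - xb) < \<rho>"
  shows "envelope z + dual_P z \<bullet> (z' - z) + modulus / 2 * (norm (z' - z))\<^sup>2 \<le> envelope z'"
proof -
  define d where "d = z' - z"
  define \<gamma> where "\<gamma> t = z + t *\<^sub>R d" for t :: real
  define \<theta> where "\<theta> t = dual_P (\<gamma> t) \<bullet> d" for t
  have ball: "norm (\<gamma> t - xb) < \<rho>" if "t \<in> {0..1}" for t
  proof -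
    have "(1 - t) *\<^sub>R z + t *\<^sub>R z' \<in> ball xb \<rho>"
      using that z z' by (intro convexD convex_ball) (auto simp: dist_norm norm_minus_commute)
    then show ?thesis
      by (simp add: \<gamma>_def d_def dist_norm norm_minus_commute algebra_simps)
  qed
  have \<theta>_lip: "\<bar>\<theta> t - \<theta> t'\<bar> \<le> 3 * \<mu> * (norm d)\<^sup>2 * \<bar>t - t'\<bar>" if "t \<in> {0..1}" "t' \<in> {0..1}" for t t'
  proof -
    have "\<bar>\<theta> t - \<theta> t'\<bar> \<le> norm (dual_P (\<gamma> t) - dual_P (\<gamma> t')) * norm d"
      unfolding \<theta>_def inner_diff_left[symmetric] by (rule Cauchy_Schwarz_ineq2)
    also have "\<dots> \<le> (3 * \<mu> * norm (\<gamma> t - \<gamma> t')) * norm d"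
      by (intro mult_right_mono dual_P_lipschitz ball that) auto
    also have "\<gamma> t - \<gamma> t' = (t - t') *\<^sub>R d" by (simp add: \<gamma>_def algebra_simps)
    finally show ?thesis by (simp add: power2_eq_square mult_ac)
  qed
  have cont_\<theta>: "continuous_on {0..1} \<theta>"
  proof (rule lipschitz_on_continuous_on)
    show "(3 * \<mu> * (norm d)\<^sup>2)-lipschitz_on {0..1} \<theta>"
      using \<theta>_lip mu_pos by (auto simp: lipschitz_on_def dist_real_def)
  qed
  define k where "k = modulus * (norm d)\<^sup>2"
  have lower: "\<theta> 0 + k * t \<le> \<theta> t" if "t \<in> {0..1}" for t
  proof (rule dini_lower_bound[OF cont_\<theta> _ that])
    fix t \<eta> :: real assume "0 \<le> t" "t < 1" "\<eta> > 0"
    then show "\<exists>\<delta>>0. \<forall>s. 0 < s \<and> s < \<delta> \<longrightarrow> \<theta> t + (k - \<eta>) * s \<le> \<theta> (t + s)"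
      using dual_P_dini[OF ball, of t \<eta> d] by (simp add: \<theta>_def \<gamma>_def k_def algebra_simps)
  qed
  \<comment> \<open>The increment is squeezed by \<open>envelope_upper\<close> in both directions:
    each use costs \<open>M/2\<close>, and replacing \<open>\<theta> t'\<close> by
    \<open>\<theta> t\<close> costs \<open>3 * M\<close>, so \<open>4 * M\<close> bounds the
    error.\<close>
  have deriv: "((\<lambda>t. envelope (\<gamma> t)) has_real_derivative \<theta> t) (at t within {0..1})" if t: "t \<in> {0..1}" for t
    unfolding has_field_derivative_def
  proof (rule has_derivativeI_sandwich[where e = 1 and H = "\<lambda>t'. 4 * \<mu> * (norm d)\<^sup>2 * \<bar>t' - t\<bar>"])
    show "bounded_linear ((*) (\<theta> t))" by (rule bounded_linear_mult_right)
    have "((\<lambda>t'. 4 * \<mu> * (norm d)\<^sup>2 * \<bar>t' - t\<bar>) \<longlongrightarrow> 4 * \<mu> * (norm d)\<^sup>2 * \<bar>t - t\<bar>) (at t within {0..1})"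
      by (intro tendsto_intros)
    then show "((\<lambda>t'. 4 * \<mu> * (norm d)\<^sup>2 * \<bar>t' - t\<bar>) \<longlongrightarrow> 0) (at t within {0..1})" by simp
    fix t' :: real assume t': "t' \<in> {0..1}" "t' \<noteq> t"
    define D where "D = t' - t"
    define M where "M = \<mu> * ((norm d)\<^sup>2 * D\<^sup>2)"
    have d1: "\<gamma> t' - \<gamma> t = D *\<^sub>R d" "\<gamma> t - \<gamma> t' = (- D) *\<^sub>R d"
      by (simp_all add: \<gamma>_def D_def algebra_simps)
    have n: "\<mu>/2 * (norm (D *\<^sub>R d))\<^sup>2 = M/2" "\<mu>/2 * (norm ((- D) *\<^sub>R d))\<^sup>2 = M/2"
      by (simp_all add: M_def power_mult_distrib)
    have "envelope (\<gamma> t') \<le> envelope (\<gamma> t) + D * \<theta> t + M/2"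
      using envelope_upper[of "\<gamma> t'" "\<gamma> t"] unfolding d1 n inner_scaleR_right \<theta>_def .
    moreover have "envelope (\<gamma> t) \<le> envelope (\<gamma> t') + - D * \<theta> t' + M/2"
      using envelope_upper[of "\<gamma> t" "\<gamma> t'"] unfolding d1 n inner_scaleR_right \<theta>_def .
    moreover have "\<bar>D * \<theta> t' - D * \<theta> t\<bar> \<le> 3 * M"
    proof -
      have "\<bar>\<theta> t' - \<theta> t\<bar> * \<bar>D\<bar> \<le> (3 * \<mu> * (norm d)\<^sup>2 * \<bar>D\<bar>) * \<bar>D\<bar>"
        unfolding D_def by (intro mult_right_mono \<theta>_lip t t') auto
      also have "\<dots> = 3 * M" by (simp add: M_def power2_eq_square)
      finally show ?thesis by (simp flip: abs_mult right_diff_distrib add: mult.commute)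
    qed
    moreover have "M \<ge> 0" using mu_pos by (simp add: M_def)
    ultimately have "\<bar>envelope (\<gamma> t') - envelope (\<gamma> t) - D * \<theta> t\<bar> \<le> 4 * M" by arith
    also have "4 * M = 4 * \<mu> * (norm d)\<^sup>2 * \<bar>D\<bar> * \<bar>D\<bar>" by (simp add: M_def power2_eq_square)
    finally show "norm (envelope (\<gamma> t') - envelope (\<gamma> t) - \<theta> t * (t' - t)) / norm (t' - t)
        \<le> 4 * \<mu> * (norm d)\<^sup>2 * \<bar>t' - t\<bar>"
      using t' unfolding D_def by (subst pos_divide_le_eq) (auto simp: mult.commute)
  qed (use t in auto)
  \<comment> \<open>The claim reads \<open>h 0 \<le> h 1\<close>, and the derivative of
    \<open>h\<close> is nonnegative by \<open>lower\<close>.\<close>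
  define h where "h t = envelope (\<gamma> t) - \<theta> 0 * t - k / 2 * t\<^sup>2" for t
  have "h 0 \<le> h 1"
  proof (rule DERIV_nonneg_imp_increasing_open[where f = h and a = 0 and b = 1])
    show "continuous_on {0..1} h"
      unfolding h_def
      by (intro continuous_intros DERIV_continuous_on[OF deriv])
    fix t :: real assume t: "0 < t" "t < 1"
    then have "((\<lambda>t. envelope (\<gamma> t)) has_real_derivative \<theta> t) (at t)"
      using deriv[of t] by (simp add: at_within_Icc_at)
    then have "(h has_real_derivative (\<theta> t - \<theta> 0 - k * t)) (at t)"
      unfolding h_def by (auto intro!: derivative_eq_intros)
    then show "\<exists>y. (h has_real_derivative y) (at t) \<and> 0 \<le> y" using lower[of t] t by auto
  qed simp
  then show ?thesis by (simp add: h_def \<theta>_def \<gamma>_def k_def d_def)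
qed

end

subsection \<open>Variational convexity and tilt stability\<close>

context prox_regular_constrained begin

text \<open>Within this radius the points \<open>z\<close> and \<open>z'\<close> in the proof of
  \<open>support\<close> stay within \<open>\<rho>\<close> of \<open>xb\<close>.\<close>

definition \<delta>0 :: real where "\<delta>0 = \<rho> / (1 + 1 / \<mu> + 2 * \<sigma> / \<mu>)"

lemma delta0: "\<delta>0 > 0" "\<delta>0 < R"
proof -
  have D: "1 + 1 / \<mu> + 2 * \<sigma> / \<mu> \<ge> 1" using mu_pos sigma_nonneg by simp
  then show "\<delta>0 > 0" unfolding \<delta>0_def using rho_pos by (intro divide_pos_pos) linarith+
  have "\<delta>0 \<le> \<rho> / 1" unfolding \<delta>0_def using D rho_pos by (intro divide_left_mono) auto
  then show "\<delta>0 < R" using R_pos by (simp add: \<rho>_def min_def split: if_splits)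
qed

text \<open>The envelope is deconvolved: its lower bound at \<open>z'\<close>, centred at the Minty
  point \<open>z\<close> of \<open>(x, v)\<close>, is compared with the upper bound given by the
  competitor \<open>u\<close>. A good choice of \<open>z'\<close> loses nothing and recovers the
  full modulus \<open>\<sigma>\<close>.\<close>

lemma support:
  assumes G: "(x, v) \<in> G" and x: "norm (x - xb) < \<delta>0" and v: "norm v < \<delta>0"
    and u: "u \<in> S" "norm (u - xb) < \<delta>0"
  shows "f x + v \<bullet> (u - x) + \<sigma>/2 * (norm (u - x))\<^sup>2 \<le> f u"
proof -
  define \<tau> where "\<tau> = \<sigma> / \<mu>"
  define a where "a = u - x"
  define p where "p = v /\<^sub>R \<mu>"
  define z where "z = x + p"
  \<comment> \<open>The Minty point of \<open>(u, v + \<sigma> *\<^sub>R a)\<close>, whose second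
    component is the gradient at \<open>u\<close> of the minorant to be proved.\<close>
  define z' where "z' = u + p + \<tau> *\<^sub>R a"
  have \<tau>: "\<tau> \<ge> 0" using mu_pos sigma_nonneg by (simp add: \<tau>_def)
  have D: "\<delta>0 * (1 + 1 / \<mu> + 2 * \<tau>) = \<rho>"
  proof -
    have "1 + 1 / \<mu> + 2 * \<sigma> / \<mu> > 0" using mu_pos sigma_nonneg by (simp add: add_pos_nonneg)
    then show ?thesis unfolding \<delta>0_def \<tau>_def by simp
  qed
  have p: "norm p \<le> \<delta>0 / \<mu>" using v mu_pos by (simp add: p_def field_simps)
  have "norm a \<le> norm (u - xb) + norm (x - xb)"
    using norm_triangle_ineq4[of "u - xb" "x - xb"] by (simp add: a_def)
  then have "norm a \<le> 2 * \<delta>0" using x u by simp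
  then have "\<tau> * norm a \<le> \<tau> * (2 * \<delta>0)" using \<tau> by (intro mult_left_mono)
  moreover have "norm (z' - xb) \<le> norm (u - xb) + norm p + \<tau> * norm a"
    using norm_triangle_ineq[of "u - xb + p" "\<tau> *\<^sub>R a"] norm_triangle_ineq[of "u - xb" p] \<tau>
    by (simp add: z'_def algebra_simps)
  ultimately have "norm (z' - xb) < \<delta>0 + \<delta>0 / \<mu> + \<tau> * (2 * \<delta>0)" using u p by linarith
  then have z': "norm (z' - xb) < \<rho>" by (simp add: D[symmetric] algebra_simps)
  have "norm (z - xb) \<le> norm (x - xb) + norm p"
    using norm_triangle_ineq[of "x - xb" p] by (simp add: z_def algebra_simps)
  then have "norm (z - xb) < \<delta>0 + \<delta>0 / \<mu> + \<tau> * (2 * \<delta>0)"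
    using x p \<tau> delta0 mult_nonneg_nonneg[of \<tau> "2 * \<delta>0"] by linarith
  then have z: "norm (z - xb) < \<rho>" by (simp add: D[symmetric] algebra_simps)
  have Pz: "P z = x" using P_eqI[OF _ z] G_is_prox[OF G] by (simp add: z_def p_def)
  have dual: "dual_P z = v" unfolding dual_P_def Pz using mu_pos by (simp add: z_def p_def)
  have env: "envelope z = f x + \<mu>/2 * (norm p)\<^sup>2" unfolding envelope_def Pz by (simp add: z_def norm_minus_commute)
  have "z' - z = (1 + \<tau>) *\<^sub>R a" by (simp add: z'_def z_def a_def algebra_simps)
  then have "envelope z + v \<bullet> ((1 + \<tau>) *\<^sub>R a) + modulus/2 * (norm ((1 + \<tau>) *\<^sub>R a))\<^sup>2 \<le> envelope z'"
    using envelope_convex[OF z z'] by (simp only: dual)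
  also have "\<dots> \<le> f u + \<mu>/2 * (norm (u - z'))\<^sup>2" using envelope_le u delta0 by simp
  also have "\<mu>/2 * (norm (u - z'))\<^sup>2 = \<mu>/2 * (norm p)\<^sup>2 + \<tau> * (v \<bullet> a) + \<mu> * \<tau>\<^sup>2 / 2 * (norm a)\<^sup>2"
  proof -
    have "norm (u - z') = norm (p + \<tau> *\<^sub>R a)"
      using norm_minus_cancel[of "p + \<tau> *\<^sub>R a"] by (simp add: z'_def algebra_simps)
    moreover have "(norm (p + \<tau> *\<^sub>R a))\<^sup>2 = (norm p)\<^sup>2 + 2 * (\<tau> * (p \<bullet> a)) + \<tau>\<^sup>2 * (norm a)\<^sup>2"
      unfolding power2_norm_eq_inner power2_eq_square[of \<tau>] by (simp add: inner_commute algebra_simps)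
    ultimately have "\<mu>/2 * (norm (u - z'))\<^sup>2 = \<mu>/2 * (norm p)\<^sup>2 + \<mu> * (\<tau> * (p \<bullet> a)) + \<mu> * \<tau>\<^sup>2 / 2 * (norm a)\<^sup>2"
      by (simp add: algebra_simps)
    also have "\<mu> * (\<tau> * (p \<bullet> a)) = \<tau> * (v \<bullet> a)" using mu_pos by (simp add: p_def)
    finally show ?thesis .
  qed
  finally have "f x + (1 + \<tau>) * (v \<bullet> a) + modulus * (1 + \<tau>)\<^sup>2 / 2 * (norm a)\<^sup>2
      \<le> f u + \<tau> * (v \<bullet> a) + \<mu> * \<tau>\<^sup>2 / 2 * (norm a)\<^sup>2"
    by (simp add: env power_mult_distrib)
  \<comment> \<open>Here \<open>\<tau> = \<sigma> / \<mu>\<close> pays off: after subtracting the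
    cost \<open>\<mu> * \<tau>\<^sup>2\<close> of the competitor exactly \<open>\<sigma>\<close>
    remains.\<close>
  moreover have "modulus * (1 + \<tau>)\<^sup>2 = \<sigma> + \<mu> * \<tau>\<^sup>2"
  proof -
    have "1 + \<tau> = (\<mu> + \<sigma>) / \<mu>" using mu_pos by (simp add: \<tau>_def add_divide_distrib)
    moreover have "\<mu> + \<sigma> \<noteq> 0" using mu_pos sigma_nonneg by linarith
    ultimately have "modulus * (1 + \<tau>) = \<sigma>" using mu_pos by (simp add: modulus_def)
    moreover have "\<sigma> = \<mu> * \<tau>" using mu_pos by (simp add: \<tau>_def)
    ultimately show ?thesis by (metis (no_types) distrib_left mult.assoc mult.right_neutral power2_eq_square)
  qed
  ultimately have "f x + (1 + \<tau>) * (v \<bullet> a) + (\<sigma> + \<mu> * \<tau>\<^sup>2) / 2 * (norm a)\<^sup>2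
      \<le> f u + \<tau> * (v \<bullet> a) + \<mu> * \<tau>\<^sup>2 / 2 * (norm a)\<^sup>2" by simp
  then show ?thesis by (simp add: a_def[symmetric] field_simps)
qed

lemma quadratic_growth:
  "u \<in> S \<Longrightarrow> norm (u - xb) < \<delta>0 \<Longrightarrow> f xb + \<sigma>/2 * (norm (u - xb))\<^sup>2 \<le> f u"
  using support[OF base_G] delta0 by simp

section \<open>The supremum of the quadratic minorants\<close>

definition support_fun :: "'a \<times> 'a \<Rightarrow> 'a \<Rightarrow> real" where
  "support_fun p u = f (fst p) + snd p \<bullet> (u - fst p) + \<sigma>/2 * (norm (u - fst p))\<^sup>2"

definition G0 :: "('a \<times> 'a) set" where
  "G0 = {p \<in> G. norm (fst p - xb) < \<delta>0 \<and> norm (snd p) < \<delta>0}"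

text \<open>The candidate for the convex minorant. It is real-valued on the whole space, by
  \<open>bdd_above_support\<close> and because \<open>G0\<close> contains
  \<open>(xb, 0)\<close>.\<close>

definition h :: "'a \<Rightarrow> real" where "h u = (SUP p\<in>G0. support_fun p u)"

lemma bdd_above_support: "bdd_above ((\<lambda>p. support_fun p u) ` G0)"
proof -
  have "bdd_above (f ` (S \<inter> cball xb R))"
    by (intro bounded_imp_bdd_above compact_imp_bounded compact_continuous_image cont compact)
  then obtain M where M: "\<And>x. x \<in> S \<inter> cball xb R \<Longrightarrow> f x \<le> M"
    unfolding bdd_above_def by blast
  define B where "B = norm (u - xb) + \<delta>0"
  have "support_fun p u \<le> M + \<delta>0 * B + \<sigma>/2 * B\<^sup>2" if p: "p \<in> G0" for p
  proof -
    obtain x v where xv: "p = (x, v)" by (cases p)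
    have x: "(x, v) \<in> G" "norm (x - xb) < \<delta>0" "norm v < \<delta>0" using p by (auto simp: G0_def xv)
    have B: "norm (u - x) \<le> B"
      using norm_triangle_ineq4[of "u - xb" "x - xb"] x by (simp add: B_def)
    have "f x \<le> M" using M G_feasible[OF x(1)] x(2) delta0 by (simp add: dist_xb)
    moreover have "v \<bullet> (u - x) \<le> \<delta>0 * B"
      using norm_cauchy_schwarz[of v "u - x"] mult_mono[OF less_imp_le[OF x(3)] B] delta0 by simp
    moreover have "\<sigma>/2 * (norm (u - x))\<^sup>2 \<le> \<sigma>/2 * B\<^sup>2"
      using B sigma_nonneg by (intro mult_left_mono power_mono) auto
    ultimately show ?thesis by (simp add: support_fun_def xv)
  qed
  then show ?thesis by (intro bdd_aboveI2)
qed

lemma base_G0: "(xb, 0) \<in> G0" using base_G delta0 by (simp add: G0_def)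

lemma h_ge: "p \<in> G0 \<Longrightarrow> support_fun p u \<le> h u"
  unfolding h_def by (rule cSUP_upper[OF _ bdd_above_support])

lemma h_le: "(\<And>p. p \<in> G0 \<Longrightarrow> support_fun p u \<le> c) \<Longrightarrow> h u \<le> c"
  unfolding h_def using base_G0 by (intro cSUP_least) auto

lemma h_le_f: "u \<in> S \<Longrightarrow> norm (u - xb) < \<delta>0 \<Longrightarrow> h u \<le> f u"
  using support by (intro h_le) (auto simp: G0_def support_fun_def)

lemma h_subgradient: "(x, v) \<in> G0 \<Longrightarrow> f x + v \<bullet> (u - x) \<le> h u"
  using h_ge[of "(x, v)" u] mult_nonneg_nonneg[OF sigma_nonneg zero_le_power2[of "norm (u - x)"]]
  unfolding support_fun_def fst_conv snd_conv by linarith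

text \<open>The minorant of \<open>(x, v)\<close> itself gives the lower bound at \<open>x\<close>,
  and \<open>support\<close> the upper one.\<close>

lemma h_eq_f: "(x, v) \<in> G0 \<Longrightarrow> h x = f x"
  using h_subgradient[of x v x] h_le_f[of x] G_feasible[of x v] by (auto simp: G0_def)

text \<open>All minorants share the same quadratic part, so \<open>h\<close> minus that part is a
  supremum of affine functions. This is the source of strong convexity with modulus
  \<open>\<sigma>\<close>.\<close>

lemma support_fun_affine: "\<exists>b c. \<forall>u. support_fun p u = \<sigma>/2 * (norm u)\<^sup>2 + b \<bullet> u + c"
proof (intro exI allI)
  show "support_fun p u = \<sigma>/2 * (norm u)\<^sup>2 + (snd p - \<sigma> *\<^sub>R fst p) \<bullet> u
      + (f (fst p) - snd p \<bullet> fst p + \<sigma>/2 * (norm (fst p))\<^sup>2)" for u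
    unfolding support_fun_def power2_norm_eq_inner
    by (simp add: inner_commute algebra_simps)
qed

lemma h_strongly_convex:
  assumes "t \<in> {0..1}"
  shows "h ((1 - t) *\<^sub>R x + t *\<^sub>R y) - \<sigma>/2 * (norm ((1 - t) *\<^sub>R x + t *\<^sub>R y))\<^sup>2
    \<le> (1 - t) * (h x - \<sigma>/2 * (norm x)\<^sup>2) + t * (h y - \<sigma>/2 * (norm y)\<^sup>2)" (is "h ?z - ?q \<le> ?r")
proof -
  have "h ?z \<le> ?r + ?q"
  proof (rule h_le)
    fix p assume p: "p \<in> G0"
    obtain b c where bc: "\<And>u. support_fun p u = \<sigma>/2 * (norm u)\<^sup>2 + b \<bullet> u + c"
      using support_fun_affine by blast
    have "(1 - t) * (b \<bullet> x + c) + t * (b \<bullet> y + c)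
        \<le> (1 - t) * (h x - \<sigma>/2 * (norm x)\<^sup>2) + t * (h y - \<sigma>/2 * (norm y)\<^sup>2)"
      using h_ge[OF p, of x] h_ge[OF p, of y] assms unfolding bc
      by (intro add_mono mult_left_mono) auto
    moreover have "b \<bullet> ?z + c = (1 - t) * (b \<bullet> x + c) + t * (b \<bullet> y + c)"
      by (simp add: inner_add_right algebra_simps)
    ultimately show "support_fun p ?z \<le> ?r + ?q" unfolding bc by linarith
  qed
  then show ?thesis by simp
qed

lemma convex_h: "convex_on UNIV h"
proof (rule convex_onI)
  fix t :: real and x y :: 'a
  assume "0 < t" "t < 1"
  then have t: "t \<in> {0..1}" by simp
  have "(norm ((1 - t) *\<^sub>R x + t *\<^sub>R y))\<^sup>2 \<le> (1 - t) * (norm x)\<^sup>2 + t * (norm y)\<^sup>2"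
  proof -
    have "(1 - t) * (norm x)\<^sup>2 + t * (norm y)\<^sup>2 - (norm ((1 - t) *\<^sub>R x + t *\<^sub>R y))\<^sup>2
        = t * (1 - t) * (norm (x - y))\<^sup>2"
      unfolding power2_norm_eq_inner by (simp add: inner_commute algebra_simps)
    then show ?thesis using t by (smt (verit) atLeastAtMost_iff mult_nonneg_nonneg zero_le_power2)
  qed
  then have "\<sigma>/2 * (norm ((1 - t) *\<^sub>R x + t *\<^sub>R y))\<^sup>2 \<le> \<sigma>/2 * ((1 - t) * (norm x)\<^sup>2 + t * (norm y)\<^sup>2)"
    using sigma_nonneg by (intro mult_left_mono) auto
  moreover have "(1 - t) * (h x - \<sigma>/2 * (norm x)\<^sup>2) + t * (h y - \<sigma>/2 * (norm y)\<^sup>2)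
      = (1 - t) * h x + t * h y - \<sigma>/2 * ((1 - t) * (norm x)\<^sup>2 + t * (norm y)\<^sup>2)"
    by (simp add: field_simps)
  ultimately show "h ((1 - t) *\<^sub>R x + t *\<^sub>R y) \<le> (1 - t) * h x + t * h y"
    using h_strongly_convex[OF t, of x y] by linarith
qed simp

lemma ereal_strongly_convex_h: "convex U \<Longrightarrow> ereal_strongly_convex_on U \<sigma> (\<lambda>u. ereal (h u))"
  unfolding ereal_strongly_convex_on_def ereal_convex_on_def
proof (rule convexI)
  fix p q :: "'a \<times> real" and a b :: real
  let ?E = "{(x, \<alpha>). x \<in> U \<and> ereal (h x) - ereal (\<sigma>/2 * (norm x)\<^sup>2) \<le> ereal \<alpha>}"
  assume U: "convex U" and pq: "p \<in> ?E" "q \<in> ?E" and ab: "0 \<le> a" "0 \<le> b" "a + b = 1"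
  obtain x \<alpha> y \<beta> where p: "p = (x, \<alpha>)" and q: "q = (y, \<beta>)" by (cases p, cases q)
  have a: "a = 1 - b" using ab by simp
  have "h ((1 - b) *\<^sub>R x + b *\<^sub>R y) - \<sigma>/2 * (norm ((1 - b) *\<^sub>R x + b *\<^sub>R y))\<^sup>2
    \<le> (1 - b) * (h x - \<sigma>/2 * (norm x)\<^sup>2) + b * (h y - \<sigma>/2 * (norm y)\<^sup>2)"
    using ab by (intro h_strongly_convex) auto
  also have "\<dots> \<le> (1 - b) * \<alpha> + b * \<beta>"
    using pq ab by (intro add_mono mult_left_mono) (auto simp: p q)
  finally show "a *\<^sub>R p + b *\<^sub>R q \<in> ?E"
    using pq ab convexD[OF U, of x y a b] by (simp add: p q a)
qed

lemma lsc_h: "lsc_at (\<lambda>u. ereal (h u)) x"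
proof -
  have "continuous_on UNIV h" using convex_on_continuous[OF open_UNIV convex_h] .
  then have "(h \<longlongrightarrow> h x) (at x)" by (simp add: continuous_on_def)
  then have "((\<lambda>u. ereal (h u)) \<longlongrightarrow> ereal (h x)) (at x)" by (rule tendsto_ereal)
  then show ?thesis unfolding lsc_at_def using lim_imp_Liminf[OF at_neq_bot] by (metis order_refl)
qed

text \<open>\<open>h\<close> serves as the minorant. A subgradient pair of the constrained function
  near \<open>(xb, 0)\<close> lies in \<open>G0\<close>, where \<open>h\<close> touches
  \<open>f\<close> and inherits the subgradient. Conversely, a subgradient pair of \<open>h\<close>
  coincides with the pair in \<open>G0\<close> that has the same Minty point.\<close>

lemma var_convex_gen_constrained:
  "var_convex_gen (\<lambda>U. ereal_strongly_convex_on U \<sigma>) (constrained f S) xb 0"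
proof -
  obtain \<delta>f where \<delta>f: "\<delta>f > 0" "\<And>x. x \<in> S \<Longrightarrow> norm (x - xb) \<le> R \<Longrightarrow> norm (x - xb) < \<delta>f \<Longrightarrow> f x < f xb + 1"
  proof -
    have "xb \<in> S \<inter> cball xb R" using xb_in_S R_pos by simp
    then obtain d where d: "d > 0" "\<And>x. x \<in> S \<inter> cball xb R \<Longrightarrow> dist x xb < d \<Longrightarrow> dist (f x) (f xb) < 1"
      using cont unfolding continuous_on_iff by (metis zero_less_one)
    have "f x < f xb + 1" if "x \<in> S" "norm (x - xb) \<le> R" "norm (x - xb) < d" for x
      using d(2)[of x] that by (auto simp: dist_real_def dist_norm norm_minus_commute)
    then show ?thesis using d(1) that by blast
  qed
  \<comment> \<open>\<open>\<delta>f\<close> puts the feasible points of \<open>U\<close> into the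
    level set with \<open>\<epsilon> = 1\<close>. The last term controls Minty points, which lie
    within \<open>\<delta>1 * (1 + 1 / \<mu>)\<close> of \<open>xb\<close>, so that
    \<open>(P z, dual_P z)\<close> falls into \<open>G0\<close>.\<close>
  define \<delta>1 where "\<delta>1 = min (min \<delta>0 \<delta>f) (min \<rho> (min (\<delta>0 / 3) (\<delta>0 / (2 * \<mu>))) / (1 + 1 / \<mu>))"
  have m1: "1 + 1 / \<mu> > 0" using mu_pos by (simp add: add_pos_pos)
  have \<delta>1: "\<delta>1 > 0" "\<delta>1 \<le> \<delta>0" "\<delta>1 \<le> \<delta>f"
    using delta0 \<delta>f rho_pos mu_pos m1 by (auto simp: \<delta>1_def)
  have "\<delta>1 \<le> min \<rho> (min (\<delta>0 / 3) (\<delta>0 / (2 * \<mu>))) / (1 + 1 / \<mu>)"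
    unfolding \<delta>1_def by (rule min.cobounded2)
  then have \<delta>1': "\<delta>1 * (1 + 1 / \<mu>) \<le> min \<rho> (min (\<delta>0 / 3) (\<delta>0 / (2 * \<mu>)))"
    by (simp only: pos_le_divide_eq[OF m1])
  let ?\<psi> = "\<lambda>u. ereal (h u)"
  define U V where "U = ball xb \<delta>1" and "V = ball (0::'a) \<delta>1"
  have U: "norm (x - xb) < \<delta>1" if "x \<in> U" for x using that by (simp add: U_def dist_xb)
  have V: "norm v < \<delta>1" if "v \<in> V" for v using that by (simp add: V_def)
  have forward: "h x = f x \<and> (x, v) \<in> gph_subdiff ?\<psi>"
    if "x \<in> U" "v \<in> V" "(x, v) \<in> gph_subdiff (constrained f S)" for x v
  proof -
    have "(x, v) \<in> G0" using that U[of x] V[of v] \<delta>1 delta0 by (auto simp: G0_def G_def gph_subdiff_def)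
    then have "h x = f x" and "\<And>u. h x + v \<bullet> (u - x) \<le> h u"
      using h_eq_f h_subgradient by fastforce+
    then show ?thesis using subgradient_imp_frechet[of h x v] frechet_subset_limiting
      by (auto simp: gph_subdiff_def)
  qed
  have backward: "(x, v) \<in> G0" if x: "x \<in> U" and v: "v \<in> V" and g: "(x, v) \<in> gph_subdiff ?\<psi>" for x v
  proof -
    have sub: "h x + v \<bullet> (u - x) \<le> h u" for u
      using convex_limiting_subdiff[OF convex_h] g by (auto simp: gph_subdiff_def)
    define z where "z = x + v /\<^sub>R \<mu>"
    have "norm (z - xb) \<le> norm (x - xb) + norm v / \<mu>"
      using norm_triangle_ineq[of "x - xb" "v /\<^sub>R \<mu>"] mu_pos by (simp add: z_def algebra_simps divide_inverse)
    also have "\<dots> < \<delta>1 + \<delta>1 / \<mu>"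
      using U[OF x] V[OF v] mu_pos by (intro add_strict_mono divide_strict_right_mono)
    also have "\<dots> = \<delta>1 * (1 + 1 / \<mu>)" by (simp add: algebra_simps)
    finally have z: "norm (z - xb) < \<rho>" "3 * norm (z - xb) < \<delta>0" "norm (z - xb) < \<delta>0 / (2 * \<mu>)"
      using \<delta>1' unfolding min.bounded_iff by linarith+
    have "norm (dual_P z) = \<mu> * norm (P z - z)"
      using mu_pos by (simp add: dual_P_def norm_minus_commute)
    also have "\<dots> \<le> \<mu> * (2 * norm (z - xb))"
      using is_prox_near[OF is_prox_P] mu_pos by simp
    also have "\<dots> < \<delta>0" using z(3) mu_pos by (simp add: pos_less_divide_eq mult_ac)
    finally have "norm (dual_P z) < \<delta>0" .
    then have G0: "(P z, dual_P z) \<in> G0"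
      using P_G[OF z(1)] is_prox_near_xb[OF is_prox_P, of z] z(2) by (simp add: G0_def)
    \<comment> \<open>Monotonicity of the subgradients of \<open>h\<close>. Both pairs have Minty
      point \<open>z\<close>, so \<open>x - P z\<close> is a positive multiple of
      \<open>dual_P z - v\<close> and both differences vanish.\<close>
    have "(dual_P z - v) \<bullet> (x - P z) \<le> 0"
      using sub[of "P z"] h_subgradient[OF G0, of x] h_eq_f[OF G0] by (simp add: inner_diff_left inner_diff_right)
    moreover have "x - P z = (dual_P z - v) /\<^sub>R \<mu>"
      using mu_pos by (simp add: dual_P_def z_def algebra_simps)
    ultimately have "(dual_P z - v) \<bullet> (dual_P z - v) \<le> 0"
      using mu_pos by (simp add: mult_le_0_iff)
    then have "dual_P z = v" by (metis eq_iff_diff_eq_0 inner_ge_zero inner_eq_zero_iff order_antisym)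
    then show ?thesis using G0 \<open>x - P z = _\<close> by simp
  qed
  have fin: "constrained f S x < constrained f S xb + ereal 1" if "x \<in> U" "x \<in> S" for x
    using \<delta>f(2)[of x] that U[of x] \<delta>1 delta0 xb_in_S by (auto simp: indicator_ext_def)
  have U\<epsilon>: "({x\<in>U. constrained f S x < constrained f S xb + ereal 1} \<times> V) \<inter> gph_subdiff (constrained f S)
      = (U \<times> V) \<inter> gph_subdiff ?\<psi>"
    using forward backward fin G_feasible by (fastforce simp: G0_def G_def gph_subdiff_def)
  show ?thesis
    unfolding var_convex_gen_def Let_def
  proof (intro exI conjI)
    show "open U" "convex U" "xb \<in> U" "open V" "convex V" "0 \<in> V" using \<delta>1 by (auto simp: U_def V_def)
    then show "ereal_strongly_convex_on U \<sigma> ?\<psi>" by (intro ereal_strongly_convex_h)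
    show "\<forall>x\<in>U. lsc_at ?\<psi> x" using lsc_h by simp
    show "\<forall>x\<in>U. ?\<psi> x \<le> constrained f S x"
      using h_le_f U \<delta>1 by (fastforce simp: indicator_ext_def)
    show "({x\<in>U. constrained f S x < constrained f S xb + ereal 1} \<times> V) \<inter> gph_subdiff (constrained f S)
      = (U \<times> V) \<inter> gph_subdiff ?\<psi>" by (rule U\<epsilon>)
    show "\<forall>(x, v) \<in> ({x\<in>U. constrained f S x < constrained f S xb + ereal 1} \<times> V) \<inter> gph_subdiff (constrained f S).
        constrained f S x = ?\<psi> x"
    proof safe
      fix x v assume a: "x \<in> U" "v \<in> V" "(x, v) \<in> gph_subdiff (constrained f S)"
      then have "(x, v) \<in> G" using U[of x] V[of v] \<delta>1 delta0 by (auto simp: G_def gph_subdiff_def)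
      then show "constrained f S x = ?\<psi> x"
        using forward[OF a] G_feasible by (simp add: indicator_ext_def)
    qed
  qed simp
qed

text \<open>Tilted minimizers exist by compactness, and quadratic growth keeps them inside the ball,
  so that the tilt is a subgradient there. \<open>support\<close> then gives uniqueness; adding it
  for two tilts gives \<open>\<sigma> * (norm (m v - m v'))\<^sup>2 \<le> (v - v') \<bullet> (m v -
  m v')\<close>, hence the Lipschitz constant.\<close>

lemma tilt_stable_constrained:
  assumes \<sigma>: "\<sigma> > 0"
  shows "tilt_stable (constrained f S) xb (1 / \<sigma>)"
proof -
  define \<gamma> where "\<gamma> = \<delta>0 / 2"
  have \<gamma>: "\<gamma> > 0" "\<gamma> < \<delta>0" using delta0 by (auto simp: \<gamma>_def)
  \<comment> \<open>Growth at a minimizer \<open>x\<close> gives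
    \<open>\<sigma>/2 * norm (x - xb) \<le> norm v\<close> for \<open>x \<noteq> xb\<close>; the
    bound \<open>\<sigma> * \<gamma> / 2\<close> therefore excludes minimizers on the
    sphere.\<close>
  define W where "W = ball (0::'a) (min \<delta>0 (\<sigma> * \<gamma> / 2))"
  note argmin = tilt_argmin_constrained[OF xb_in_S less_imp_le[OF \<gamma>(1)], of _ f]
  have ex: "\<exists>x. tilt_argmin (constrained f S) xb \<gamma> v = {x} \<and> (x, v) \<in> G0" if v: "v \<in> W" for v
  proof -
    have nv: "norm v < \<delta>0" "norm v < \<sigma> * \<gamma> / 2" using v by (auto simp: W_def)
    have sub: "S \<inter> cball xb \<gamma> \<subseteq> S \<inter> cball xb R" using \<gamma> delta0 by auto
    have eq: "S \<inter> cball xb \<gamma> = (S \<inter> cball xb R) \<inter> cball xb \<gamma>" using \<gamma> delta0 by auto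
    have c1: "compact (S \<inter> cball xb \<gamma>)" unfolding eq by (intro compact_Int_closed compact closed_cball)
    have c2: "continuous_on (S \<inter> cball xb \<gamma>) (\<lambda>x. f x - v \<bullet> x)"
      by (intro continuous_intros continuous_on_subset[OF cont sub])
    have c3: "S \<inter> cball xb \<gamma> \<noteq> {}" using xb_in_S \<gamma> by force
    obtain x where x: "x \<in> S \<inter> cball xb \<gamma>"
      "\<And>z. z \<in> S \<inter> cball xb \<gamma> \<Longrightarrow> f x - v \<bullet> x \<le> f z - v \<bullet> z"
      using continuous_attains_inf[OF c1 c3 c2] by blast
    have nx: "norm (x - xb) \<le> \<gamma>" using x by (simp add: dist_xb)
    have "f xb + \<sigma>/2 * (norm (x - xb))\<^sup>2 \<le> f x" using quadratic_growth x nx \<gamma> by simp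
    moreover have "f x - v \<bullet> x \<le> f xb - v \<bullet> xb" using x(2)[of xb] xb_in_S \<gamma> by simp
    ultimately have "\<sigma>/2 * (norm (x - xb))\<^sup>2 \<le> v \<bullet> (x - xb)" by (simp add: inner_diff_right)
    also have "\<dots> \<le> norm v * norm (x - xb)" by (rule norm_cauchy_schwarz)
    finally have bound: "(\<sigma>/2 * norm (x - xb)) * norm (x - xb) \<le> norm v * norm (x - xb)"
      by (simp add: power2_eq_square)
    have "norm (x - xb) < \<gamma>"
    proof (cases "norm (x - xb) = 0")
      case False
      then have "\<sigma>/2 * norm (x - xb) \<le> norm v"
        using mult_right_le_imp_le[OF bound] by simp
      then have "\<sigma>/2 * norm (x - xb) < \<sigma>/2 * \<gamma>" using nv by simp
      then show ?thesis using \<sigma> by simp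
    qed (use \<gamma> in simp)
    have "v \<in> frechet_subdiff (constrained f S) x"
    proof (rule proximal_imp_frechet)
      show "\<gamma> - norm (x - xb) > 0" using \<open>norm (x - xb) < \<gamma>\<close> by simp
      fix u assume u: "u \<in> S \<inter> ball x (\<gamma> - norm (x - xb))"
      then have "u \<in> S \<inter> cball xb \<gamma>"
        using norm_triangle_ineq[of "u - x" "x - xb"] by (auto simp: dist_xb) (auto simp: dist_norm norm_minus_commute)
      then show "f x + v \<bullet> (u - x) - 0 * (norm (u - x))\<^sup>2 \<le> f u"
        using x(2)[of u] by (simp add: inner_diff_right)
    qed (use x in simp)
    then have G: "(x, v) \<in> G" using frechet_subset_limiting nv nx \<gamma> delta0 by (auto simp: G_def)
    have "x' = x" if "x' \<in> tilt_argmin (constrained f S) xb \<gamma> v" for x'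
    proof -
      have x': "x' \<in> S" "norm (x' - xb) \<le> \<gamma>" "f x' - v \<bullet> x' \<le> f x - v \<bullet> x"
        using that x unfolding argmin by (auto simp: dist_xb)
      have "f x + v \<bullet> (x' - x) + \<sigma>/2 * (norm (x' - x))\<^sup>2 \<le> f x'"
        using support[OF G] nx nv x' \<gamma> by simp
      then have "\<sigma>/2 * (norm (x' - x))\<^sup>2 \<le> 0" using x'(3) by (simp add: inner_diff_right)
      then show ?thesis using \<sigma> by (simp add: mult_le_0_iff)
    qed
    moreover have "x \<in> tilt_argmin (constrained f S) xb \<gamma> v" unfolding argmin using x by blast
    ultimately have "tilt_argmin (constrained f S) xb \<gamma> v = {x}" by blast
    then show ?thesis using G nx nv \<gamma> by (auto simp: G0_def)
  qed
  define m where "m v = (SOME x. tilt_argmin (constrained f S) xb \<gamma> v = {x} \<and> (x, v) \<in> G0)" for v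
  have m: "tilt_argmin (constrained f S) xb \<gamma> v = {m v}" "(m v, v) \<in> G0" if "v \<in> W" for v
    using someI_ex[OF ex[OF that]] unfolding m_def by auto
  have lip: "norm (m v - m v') \<le> 1 / \<sigma> * norm (v - v')" if v: "v \<in> W" "v' \<in> W" for v v'
  proof -
    have *: "f (m v) + v \<bullet> (m v' - m v) + \<sigma>/2 * (norm (m v' - m v))\<^sup>2 \<le> f (m v')" if "v \<in> W" "v' \<in> W" for v v'
      using m(2)[OF that(1)] m(2)[OF that(2)] by (intro support G_feasible[of "m v'" v']) (auto simp: G0_def)
    have "\<sigma> * (norm (m v - m v'))\<^sup>2 \<le> (v - v') \<bullet> (m v - m v')"
      using *[OF v] *[OF v(2,1)]
      by (simp add: inner_diff_left inner_diff_right norm_minus_commute)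
    also have "\<dots> \<le> norm (v - v') * norm (m v - m v')" by (rule norm_cauchy_schwarz)
    finally have "(\<sigma> * norm (m v - m v')) * norm (m v - m v') \<le> norm (v - v') * norm (m v - m v')"
      by (simp add: power2_eq_square)
    then have "\<sigma> * norm (m v - m v') \<le> norm (v - v')"
      by (cases "norm (m v - m v') = 0") (auto dest!: mult_right_le_imp_le)
    then show ?thesis using \<sigma> by (simp add: field_simps)
  qed
  have "0 \<in> W" using delta0 \<gamma> \<sigma> by (simp add: W_def)
  have "xb \<in> tilt_argmin (constrained f S) xb \<gamma> 0"
    unfolding argmin
  proof (intro conjI ballI)
    fix z assume "z \<in> S \<inter> cball xb \<gamma>"
    then have "f xb + \<sigma>/2 * (norm (z - xb))\<^sup>2 \<le> f z" using quadratic_growth \<gamma> by (simp add: dist_xb)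
    then show "f xb - 0 \<bullet> xb \<le> f z - 0 \<bullet> z"
      using mult_nonneg_nonneg[OF sigma_nonneg zero_le_power2[of "norm (z - xb)"]]
      unfolding inner_zero_left by linarith
  qed (use xb_in_S \<gamma> in auto)
  then have "tilt_argmin (constrained f S) xb \<gamma> 0 = {xb}" using m(1)[OF \<open>0 \<in> W\<close>] by simp
  then show ?thesis
    unfolding tilt_stable_def
    using \<gamma>(1) \<open>0 \<in> W\<close> m(1) lip \<sigma>
    by (intro exI[of _ \<gamma>] exI[of _ W] exI[of _ m] conjI)
       (auto simp: W_def lipschitz_on_def dist_norm)
qed

end

subsection \<open>Polyhedral normal cones and multipliers\<close>

lemma polyhedron_inequalities:
  fixes \<Theta> :: "'b::euclidean_space set"
  assumes "polyhedron \<Theta>"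
  obtains F :: "'b set set" and a :: "'b set \<Rightarrow> 'b" and b
  where "finite F" "\<Theta> = {z. \<forall>h\<in>F. a h \<bullet> z \<le> b h}"
proof -
  obtain F where F: "finite F" "\<Theta> = \<Inter>F" "\<forall>h\<in>F. \<exists>a b. a \<noteq> 0 \<and> h = {x. a \<bullet> x \<le> b}"
    using assms unfolding polyhedron_def by blast
  from F(3) obtain a b where "\<forall>h\<in>F. h = {x. a h \<bullet> x \<le> b h}" by metis
  then have "\<Theta> = {z. \<forall>h\<in>F. a h \<bullet> z \<le> b h}" unfolding F(2) by blast
  then show ?thesis using F(1) that by blast
qed

locale inequality_system =
  fixes F :: "'i set" and a :: "'i \<Rightarrow> 'b::euclidean_space" and b :: "'i \<Rightarrow> real" and \<Theta> :: "'b set"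
  assumes finite_F: "finite F" and \<Theta>_eq: "\<Theta> = {z. \<forall>h\<in>F. a h \<bullet> z \<le> b h}"
begin

definition active :: "'b \<Rightarrow> 'i set" where "active z = {h\<in>F. a h \<bullet> z = b h}"

text \<open>Active inequalities are preserved by the sign of \<open>a h \<bullet> d\<close>,
  inactive ones by continuity; finitely many have to be met at once.\<close>

lemma eventually_feasible_direction:
  assumes z: "z \<in> \<Theta>" and d: "\<And>h. h \<in> active z \<Longrightarrow> a h \<bullet> d \<le> 0"
  shows "\<forall>\<^sub>F t in at_right 0. z + t *\<^sub>R d \<in> \<Theta>"
proof -
  have "\<forall>\<^sub>F t in at_right 0. a h \<bullet> (z + t *\<^sub>R d) \<le> b h" if h: "h \<in> F" for h
  proof (cases "h \<in> active z")
    case True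
    have "\<forall>\<^sub>F t in at_right 0. (0::real) < t" by (rule eventually_at_right_less)
    then show ?thesis
      by eventually_elim (use d[OF True] True in \<open>auto simp: active_def inner_add_right mult_le_0_iff\<close>)
  next
    case False
    have "((\<lambda>t. a h \<bullet> (z + t *\<^sub>R d)) \<longlongrightarrow> a h \<bullet> (z + 0 *\<^sub>R d)) (at_right 0)"
      by (intro tendsto_intros)
    moreover have "a h \<bullet> (z + 0 *\<^sub>R d) < b h" using False h z by (auto simp: active_def \<Theta>_eq less_le)
    ultimately have "\<forall>\<^sub>F t in at_right 0. a h \<bullet> (z + t *\<^sub>R d) < b h" by (rule order_tendstoD(2))
    then show ?thesis by eventually_elim simp
  qed
  then have "\<forall>\<^sub>F t in at_right 0. \<forall>h\<in>F. a h \<bullet> (z + t *\<^sub>R d) \<le> b h"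
    by (intro eventually_ball_finite finite_F) blast
  then show ?thesis by (simp add: \<Theta>_eq)
qed

lemma active_normal: "z \<in> \<Theta> \<Longrightarrow> h \<in> active z \<Longrightarrow> a h \<in> normal_cone \<Theta> z"
  by (auto simp: normal_cone_def active_def \<Theta>_eq inner_diff_right)

text \<open>For \<open>u\<close> in \<open>\<Theta>\<close> the direction \<open>u - z\<close> is
  feasible at \<open>z'\<close> as well, where \<open>y\<close> can be tested on it. So the normal
  cone depends on the active set alone, which leaves finitely many cones.\<close>

lemma normal_cone_mono_active:
  assumes z: "z \<in> \<Theta>" "z' \<in> \<Theta>" and act: "active z' \<subseteq> active z"
  shows "normal_cone \<Theta> z' \<subseteq> normal_cone \<Theta> z"
proof
  fix y assume y: "y \<in> normal_cone \<Theta> z'"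
  have "y \<bullet> (u - z) \<le> 0" if u: "u \<in> \<Theta>" for u
  proof -
    have "\<forall>\<^sub>F t in at_right 0. z' + t *\<^sub>R (u - z) \<in> \<Theta>"
      using act u by (intro eventually_feasible_direction z) (auto simp: active_def \<Theta>_eq inner_diff_right)
    then have "\<forall>\<^sub>F t in at_right 0. (0::real) < t \<and> z' + t *\<^sub>R (u - z) \<in> \<Theta>"
      using eventually_at_right_less by eventually_elim simp
    then obtain t :: real where t: "t > 0" "z' + t *\<^sub>R (u - z) \<in> \<Theta>"
      using eventually_happens' trivial_limit_at_right_real by blast
    then have "y \<bullet> (t *\<^sub>R (u - z)) \<le> 0" using y z by (force simp: normal_cone_def)
    then show ?thesis using t by (simp add: mult_le_0_iff)
  qed
  then show "y \<in> normal_cone \<Theta> z" using z by (simp add: normal_cone_def)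
qed

lemma eventually_active_subset: "\<forall>\<^sub>F z' in nhds z. z \<in> \<Theta> \<longrightarrow> active z' \<subseteq> active z"
proof (cases "z \<in> \<Theta>")
  case True
  have "\<forall>\<^sub>F z' in nhds z. \<forall>h\<in>F - active z. a h \<bullet> z' < b h"
  proof (intro eventually_ball_finite ballI)
    fix h assume h: "h \<in> F - active z"
    have "((\<lambda>z'. a h \<bullet> z') \<longlongrightarrow> a h \<bullet> z) (nhds z)" by (intro tendsto_intros filterlim_ident)
    moreover have "a h \<bullet> z < b h" using h True by (auto simp: active_def \<Theta>_eq less_le)
    ultimately show "\<forall>\<^sub>F z' in nhds z. a h \<bullet> z' < b h" by (rule order_tendstoD(2))
  qed (use finite_F in simp)
  then show ?thesis by eventually_elim (force simp: active_def)
qed simp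

lemma closed_\<Theta>: "closed \<Theta>"
proof -
  have "\<Theta> = (\<Inter>h\<in>F. {z. a h \<bullet> z \<le> b h})" by (auto simp: \<Theta>_eq)
  then show ?thesis by (auto intro: closed_halfspace_le)
qed

end

lemma closed_normal_cone: "closed (normal_cone C z)"
proof (cases "z \<in> C")
  case True
  then have "normal_cone C z = (\<Inter>u\<in>C. {y. (u - z) \<bullet> y \<le> 0})"
    by (auto simp: normal_cone_def inner_commute)
  then show ?thesis by (auto intro: closed_halfspace_le)
qed (simp add: normal_cone_def)

lemma convex_normal_cone: "convex (normal_cone C z)"
proof (cases "z \<in> C")
  case True
  then have "normal_cone C z = (\<Inter>u\<in>C. {y. (u - z) \<bullet> y \<le> 0})"
    by (auto simp: normal_cone_def inner_commute)
  then show ?thesis by (auto intro: convex_INT convex_halfspace_le)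
qed (simp add: normal_cone_def)

lemma normal_cone_limit:
  fixes zs :: "nat \<Rightarrow> 'b::real_inner"
  assumes "closed C" "zs \<longlonglongrightarrow> z" "ys \<longlonglongrightarrow> y" "\<And>k. ys k \<in> normal_cone C (zs k)"
  shows "y \<in> normal_cone C z"
proof -
  have zC: "zs k \<in> C" and le: "u \<in> C \<Longrightarrow> ys k \<bullet> (u - zs k) \<le> 0" for k u
    using assms(4)[of k] by (auto simp: normal_cone_def split: if_splits)
  have "z \<in> C" using closed_sequentially[OF assms(1) _ assms(2)] zC by blast
  moreover have "y \<bullet> (u - z) \<le> 0" if "u \<in> C" for u
  proof (rule LIMSEQ_le_const2)
    show "(\<lambda>k. ys k \<bullet> (u - zs k)) \<longlonglongrightarrow> y \<bullet> (u - z)" by (intro tendsto_intros assms)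
  qed (use le that in auto)
  ultimately show ?thesis by (simp add: normal_cone_def)
qed

text \<open>A polyhedron has only finitely many normal cones, so along a subsequence \<open>normal_cone \<Theta> (zs k)\<close>
  is constant; being closed, it then contains the limit \<open>y\<close> as well.\<close>

lemma polyhedral_normal_limit:
  fixes \<Theta> :: "'b::euclidean_space set"
  assumes poly: "polyhedron \<Theta>" and zs: "zs \<longlonglongrightarrow> z" and ys: "ys \<longlonglongrightarrow> y"
    and N: "\<And>k::nat. ys k \<in> normal_cone \<Theta> (zs k)"
  obtains \<tau> :: "nat \<Rightarrow> nat" where "strict_mono \<tau>"
    "\<And>k. y \<bullet> (zs (\<tau> k) - z) = 0" "\<And>k. ys (\<tau> k) \<bullet> (zs (\<tau> k) - z) = 0"
proof -
  obtain F :: "'b set set" and a b where Fab: "finite F" "\<Theta> = {z. \<forall>h\<in>F. a h \<bullet> z \<le> b h}"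
    using polyhedron_inequalities[OF poly] .
  interpret inequality_system F a b \<Theta> by unfold_locales (use Fab in auto)
  have z\<Theta>: "zs k \<in> \<Theta>" for k using N[of k] by (auto simp: normal_cone_def split: if_splits)
  have yN: "y \<in> normal_cone \<Theta> z" using normal_cone_limit[OF closed_\<Theta> zs ys N] .
  then have z: "z \<in> \<Theta>" by (auto simp: normal_cone_def split: if_splits)
  have "finite (range (\<lambda>k. active (zs k)))"
    by (rule finite_subset[of _ "Pow F"]) (auto simp: active_def finite_F)
  then obtain k0 where inf: "infinite {k \<in> UNIV. active (zs k) = active (zs k0)}"
    using pigeonhole_infinite[of "UNIV::nat set" "\<lambda>k. active (zs k)"] by auto
  obtain \<tau>1 :: "nat \<Rightarrow> nat" where mono: "strict_mono \<tau>1" and "\<forall>k. \<tau>1 k \<in> {k \<in> UNIV. active (zs k) = active (zs k0)}"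
    using infinite_enumerate[OF inf] by blast
  then have \<tau>1: "strict_mono \<tau>1" "\<And>k. active (zs (\<tau>1 k)) = active (zs k0)" by simp_all
  have Neq: "normal_cone \<Theta> (zs (\<tau>1 k)) = normal_cone \<Theta> (zs k0)" for k
    using normal_cone_mono_active[of "zs (\<tau>1 k)" "zs k0"] normal_cone_mono_active[of "zs k0" "zs (\<tau>1 k)"]
      \<tau>1(2) z\<Theta> by blast
  have "(\<lambda>k. ys (\<tau>1 k)) \<longlonglongrightarrow> y" using LIMSEQ_subseq_LIMSEQ[OF ys \<tau>1(1)] by (simp add: o_def)
  moreover have "ys (\<tau>1 k) \<in> normal_cone \<Theta> (zs k0)" for k using N Neq by blast
  ultimately have yN0: "y \<in> normal_cone \<Theta> (zs k0)"
    using closed_sequentially[of "normal_cone \<Theta> (zs k0)" "\<lambda>k. ys (\<tau>1 k)" y] closed_normal_cone by blast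
  have "\<forall>\<^sub>F k in sequentially. active (zs k) \<subseteq> active z"
    using eventually_compose_filterlim[OF eventually_active_subset zs] z by simp
  then obtain K where K: "\<And>k. k \<ge> K \<Longrightarrow> active (zs k) \<subseteq> active z"
    by (auto simp: eventually_sequentially)
  \<comment> \<open>The shift by \<open>K\<close> brings the points close enough to \<open>z\<close>
    for their normals to be normal at \<open>z\<close> too.\<close>
  define \<tau> where "\<tau> k = \<tau>1 (k + K)" for k
  have \<tau>: "strict_mono \<tau>" using \<tau>1(1) by (auto simp: \<tau>_def strict_mono_def)
  have "K \<le> \<tau> k" for k using seq_suble[OF \<tau>1(1), of "k + K"] by (simp add: \<tau>_def)
  then have sub: "normal_cone \<Theta> (zs (\<tau> k)) \<subseteq> normal_cone \<Theta> z" for k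
    using K z z\<Theta> by (intro normal_cone_mono_active) auto
  \<comment> \<open>A vector normal at both points, tested at each against the other, is orthogonal
    to their difference.\<close>
  have orth: "y' \<bullet> (zs (\<tau> k) - z) = 0" if "y' \<in> normal_cone \<Theta> (zs (\<tau> k))" for y' k
  proof -
    have "y' \<in> normal_cone \<Theta> z" using sub that by blast
    then have "y' \<bullet> (zs (\<tau> k) - z) \<le> 0" using z\<Theta> by (auto simp: normal_cone_def split: if_splits)
    moreover have "y' \<bullet> (z - zs (\<tau> k)) \<le> 0" using that z by (auto simp: normal_cone_def split: if_splits)
    ultimately show ?thesis by (simp add: inner_diff_right)
  qed
  have "y \<in> normal_cone \<Theta> (zs (\<tau> k))" for k using yN0 Neq by (simp add: \<tau>_def)
  then show ?thesis using that[OF \<tau>] orth N by blast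
qed

section \<open>Multipliers from metric subregularity\<close>

text \<open>A Frechet derivative also handles directions that vary with \<open>k\<close>: the
  quotients \<open>W k\<close> are bounded, so the remainder is small compared with
  \<open>s k\<close>.\<close>

lemma has_derivative_along_sequence:
  assumes F: "(F has_derivative F') (at x)" and s: "\<And>k. s k > (0::real)" "s \<longlonglongrightarrow> 0"
    and w: "(\<lambda>k. (xs k - x) /\<^sub>R s k) \<longlonglongrightarrow> w"
  shows "(\<lambda>k. (F (xs k) - F x) /\<^sub>R s k) \<longlonglongrightarrow> F' w"
proof -
  interpret bounded_linear F' using F by (rule has_derivative_bounded_linear)
  define W where "W k = (xs k - x) /\<^sub>R s k" for k
  have xs: "xs k = x + s k *\<^sub>R W k" for k using s(1)[of k] by (simp add: W_def)
  have W: "W \<longlonglongrightarrow> w" using w by (simp add: W_def[abs_def])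
  have lim: "xs \<longlonglongrightarrow> x"
  proof -
    have "(\<lambda>k. x + s k *\<^sub>R W k) \<longlonglongrightarrow> x + 0 *\<^sub>R w" by (intro tendsto_intros s W)
    then show ?thesis by (simp add: xs[symmetric])
  qed
  have "Bseq W" using W by (intro convergent_imp_Bseq) (auto simp: convergent_def)
  then obtain B where B: "B > 0" "\<And>k. norm (W k) \<le> B" by (auto simp: Bseq_def)
  have "(\<lambda>k. (F (xs k) - F x) /\<^sub>R s k - F' (W k)) \<longlonglongrightarrow> 0"
  proof (rule LIMSEQ_I)
    fix r :: real assume r: "r > 0"
    define e where "e = r / (2 * B)"
    have e: "e > 0" using r B by (simp add: e_def)
    obtain d where d: "d > 0" "\<And>y. norm (y - x) < d \<Longrightarrow> norm (F y - F x - F' (y - x)) \<le> e * norm (y - x)"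
      using F e unfolding has_derivative_at_alt by blast
    obtain N where N: "\<And>k. k \<ge> N \<Longrightarrow> norm (xs k - x) < d" using LIMSEQ_D[OF lim d(1)] by blast
    have "norm ((F (xs k) - F x) /\<^sub>R s k - F' (W k) - 0) < r" if "k \<ge> N" for k
    proof -
      have eq: "(F (xs k) - F x) /\<^sub>R s k - F' (W k) = (F (xs k) - F x - F' (xs k - x)) /\<^sub>R s k"
        using s(1)[of k] by (simp add: xs scaleR algebra_simps)
      have "norm (F (xs k) - F x - F' (xs k - x)) \<le> e * (s k * norm (W k))"
        using d(2)[OF N[OF that]] s(1)[of k] by (simp add: xs)
      also have "\<dots> \<le> e * (s k * B)" using e s(1)[of k] B(2) by (intro mult_left_mono) auto
      finally have "norm (F (xs k) - F x - F' (xs k - x)) / s k \<le> e * B"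
        using s(1)[of k] by (simp add: pos_divide_le_eq mult_ac)
      then have "norm ((F (xs k) - F x - F' (xs k - x)) /\<^sub>R s k) \<le> e * B"
        using s(1)[of k] by (simp add: divide_inverse mult.commute)
      also have "\<dots> < r" using r B by (simp add: e_def)
      finally show ?thesis unfolding eq by simp
    qed
    then show "\<exists>N. \<forall>k\<ge>N. norm ((F (xs k) - F x) /\<^sub>R s k - F' (W k) - 0) < r" by blast
  qed
  moreover have "(\<lambda>k. F' (W k)) \<longlonglongrightarrow> F' w" by (intro tendsto W)
  ultimately have "(\<lambda>k. ((F (xs k) - F x) /\<^sub>R s k - F' (W k)) + F' (W k)) \<longlonglongrightarrow> 0 + F' w"
    by (rule tendsto_add)
  then show ?thesis by simp
qed

text \<open>The multiplier is obtained by separating \<open>p\<close> from the compact convex set of all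
  \<open>adjoint A y\<close> with \<open>y\<close> a normal of norm at most \<open>\<kappa> * norm p\<close>: the support function of that
  set at \<open>w\<close> is \<open>\<kappa> * norm p\<close> times the distance of \<open>A w\<close> to the tangent cone of \<open>\<Theta>\<close>, which by
  metric subregularity bounds \<open>p \<bullet> w\<close>.\<close>

lemma MSCQ_multiplier:
  fixes g :: "'a::euclidean_space \<Rightarrow> 'b::euclidean_space"
  assumes poly: "polyhedron \<Theta>" and g: "(g has_derivative A) (at x)" and x: "g x \<in> \<Theta>"
    and \<kappa>: "\<kappa> > 0" and d: "d > 0"
    and mscq: "\<And>u. u \<in> ball x d \<Longrightarrow> infdist u {x. g x \<in> \<Theta>} \<le> \<kappa> * infdist (g u) \<Theta>"
    and p: "\<And>\<epsilon>. \<epsilon> > 0 \<Longrightarrow> \<exists>\<delta>>0. \<forall>u\<in>{x. g x \<in> \<Theta>} \<inter> ball x \<delta>. p \<bullet> (u - x) \<le> \<epsilon> * norm (u - x)"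
  shows "\<exists>y\<in>normal_cone \<Theta> (g x). norm y \<le> \<kappa> * norm p \<and> adjoint A y = p"
proof (rule ccontr)
  assume no: "\<not> ?thesis"
  obtain F :: "'b set set" and a b where Fab: "finite F" "\<Theta> = {z. \<forall>h\<in>F. a h \<bullet> z \<le> b h}"
    using polyhedron_inequalities[OF poly] .
  interpret inequality_system F a b \<Theta> by unfold_locales (use Fab in auto)
  interpret A: bounded_linear A using g by (rule has_derivative_bounded_linear)
  have linA: "linear A" by (rule A.linear_axioms)
  define \<Gamma> where "\<Gamma> = {x. g x \<in> \<Theta>}"
  have x\<Gamma>: "x \<in> \<Gamma>" using x by (simp add: \<Gamma>_def)
  \<comment> \<open>The polar of the normal cone, that is, the tangent cone of
    \<open>\<Theta>\<close> at \<open>g x\<close>.\<close>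
  define T where "T = {d. \<forall>y\<in>normal_cone \<Theta> (g x). y \<bullet> d \<le> 0}"
  have bound: "p \<bullet> w \<le> norm p * (\<kappa> * norm (A w - d'))" if d': "d' \<in> T" for w d'
  proof -
    define c where "c = norm (A w - d')"
    \<comment> \<open>\<open>t * \<rho> \<epsilon>\<close> bounds the distance from
      \<open>x + t *\<^sub>R w\<close> to a feasible point: the image is within
      \<open>t * (c + \<epsilon>)\<close> of \<open>\<Theta>\<close>, subregularity multiplies this
      by \<open>\<kappa>\<close>, and the extra \<open>\<epsilon>\<close> makes the inequality
      strict, since the infimum need not be attained.\<close>
    define \<rho> where "\<rho> \<epsilon> = \<kappa> * (c + \<epsilon>) + \<epsilon>" for \<epsilon>
    have le: "p \<bullet> w \<le> \<epsilon> * (norm w + \<rho> \<epsilon>) + norm p * \<rho> \<epsilon>" if \<epsilon>: "\<epsilon> > 0" for \<epsilon>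
    proof -
      have \<rho>: "\<rho> \<epsilon> > 0" using \<epsilon> \<kappa> by (auto simp: \<rho>_def c_def intro!: add_nonneg_pos)
      obtain \<delta> where \<delta>: "\<delta> > 0" "\<And>u. u \<in> \<Gamma> \<Longrightarrow> u \<in> ball x \<delta> \<Longrightarrow> p \<bullet> (u - x) \<le> \<epsilon> * norm (u - x)"
        using p[OF \<epsilon>] unfolding \<Gamma>_def by blast
      define e where "e = \<epsilon> / (norm w + 1)"
      have e: "e > 0" "e * norm w \<le> \<epsilon>"
      proof -
        have "norm w + 1 > 0" by (simp add: add_nonneg_pos)
        then show "e > 0" "e * norm w \<le> \<epsilon>" using \<epsilon> by (simp_all add: e_def field_simps)
      qed
      obtain \<delta>' where \<delta>': "\<delta>' > 0"
        "\<And>u. norm (u - x) < \<delta>' \<Longrightarrow> norm (g u - g x - A (u - x)) \<le> e * norm (u - x)"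
        using g e(1) unfolding has_derivative_at_alt by blast
      \<comment> \<open>For \<open>t < m\<close> the point \<open>u\<close> stays where
        differentiability and subregularity apply, and the nearby feasible \<open>u'\<close> stays
        where \<open>p\<close> can be tested.\<close>
      define m where "m = min (min \<delta>' d) \<delta> / (norm w + \<rho> \<epsilon> + 1)"
      have wp: "norm w + \<rho> \<epsilon> + 1 > 0" using \<rho> by (simp add: add_nonneg_pos)
      have m: "m > 0" using \<delta> \<delta>' d wp by (simp add: m_def)
      have "\<forall>\<^sub>F t in at_right 0. g x + t *\<^sub>R d' \<in> \<Theta>"
        using d' active_normal[OF x] by (intro eventually_feasible_direction x) (auto simp: T_def)
      moreover have "\<forall>\<^sub>F t in at_right 0. (0::real) < t" by (rule eventually_at_right_less)
      moreover have "\<forall>\<^sub>F t in at_right 0. t < m" using eventually_at_right_real[OF m] by eventually_elim simp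
      ultimately have "\<forall>\<^sub>F t in at_right 0. g x + t *\<^sub>R d' \<in> \<Theta> \<and> 0 < t \<and> t < m"
        by eventually_elim simp
      then obtain t where t: "g x + t *\<^sub>R d' \<in> \<Theta>" "0 < t" "t < m"
        using eventually_happens' trivial_limit_at_right_real by blast
      have tm: "t * (norm w + \<rho> \<epsilon> + 1) < min (min \<delta>' d) \<delta>"
        using t(3) wp by (simp add: m_def pos_less_divide_eq)
      have tw: "t * norm w + t * \<rho> \<epsilon> + t = t * (norm w + \<rho> \<epsilon> + 1)" by (simp add: algebra_simps)
      have pos: "t * norm w \<ge> 0" "t * \<rho> \<epsilon> > 0" using t \<rho> by auto
      define u where "u = x + t *\<^sub>R w"
      have ux: "norm (u - x) = t * norm w" using t by (simp add: u_def)
      have u: "norm (u - x) < \<delta>'" "u \<in> ball x d"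
        using tm tw pos t ux by (auto simp: dist_norm norm_minus_commute)
      have "infdist (g u) \<Theta> \<le> dist (g u) (g x + t *\<^sub>R d')" by (rule infdist_le[OF t(1)])
      also have "\<dots> = norm ((g u - g x - A (u - x)) + t *\<^sub>R (A w - d'))"
        by (simp add: dist_norm u_def A.scaleR algebra_simps)
      also have "\<dots> \<le> e * (t * norm w) + t * c"
        using norm_triangle_ineq[of "g u - g x - A (u - x)" "t *\<^sub>R (A w - d')"] \<delta>'(2)[OF u(1)] t ux
        by (simp add: c_def)
      also have "\<dots> \<le> t * (c + \<epsilon>)"
        using mult_left_mono[OF e(2), of t] t by (simp add: algebra_simps)
      finally have "infdist u \<Gamma> \<le> \<kappa> * (t * (c + \<epsilon>))"
        using mscq[OF u(2)] \<kappa> unfolding \<Gamma>_def by (meson mult_left_mono less_imp_le order_trans)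
      also have "\<dots> < t * \<rho> \<epsilon>" using t \<epsilon> by (simp add: \<rho>_def algebra_simps)
      finally have "infdist u \<Gamma> < t * \<rho> \<epsilon>" .
      moreover have "\<Gamma> \<noteq> {}" using x\<Gamma> by blast
      ultimately have "(INF a\<in>\<Gamma>. dist u a) < t * \<rho> \<epsilon>" by (simp add: infdist_notempty)
      then obtain u' where u': "u' \<in> \<Gamma>" "dist u u' < t * \<rho> \<epsilon>"
        using cINF_less_iff[OF \<open>\<Gamma> \<noteq> {}\<close> bdd_below_image_dist] by blast
      have n1: "norm (u - u') \<le> t * \<rho> \<epsilon>" using u' by (simp add: dist_norm)
      have n2: "norm (u' - x) \<le> t * norm w + t * \<rho> \<epsilon>"
        using norm_triangle_ineq4[of "u - x" "u - u'"] n1 ux by (simp add: algebra_simps)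
      have "u' \<in> ball x \<delta>" using n2 tm tw t by (simp add: dist_norm norm_minus_commute)
      then have "p \<bullet> (u' - x) \<le> \<epsilon> * norm (u' - x)" using \<delta>(2) u' by blast
      also have "\<dots> \<le> \<epsilon> * (t * norm w + t * \<rho> \<epsilon>)" using n2 \<epsilon> by simp
      finally have 1: "p \<bullet> (u' - x) \<le> \<epsilon> * (t * norm w + t * \<rho> \<epsilon>)" .
      have 2: "p \<bullet> (u - u') \<le> norm p * (t * \<rho> \<epsilon>)"
        using norm_cauchy_schwarz[of p "u - u'"] mult_left_mono[OF n1, of "norm p"] by simp
      have "t * (p \<bullet> w) = p \<bullet> (u' - x) + p \<bullet> (u - u')" by (simp add: u_def inner_diff_right inner_add_right)
      also have "\<dots> \<le> t * (\<epsilon> * (norm w + \<rho> \<epsilon>) + norm p * \<rho> \<epsilon>)" using 1 2 by (simp add: algebra_simps)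
      finally show ?thesis using t by simp
    qed
    have "((\<lambda>\<epsilon>. \<epsilon> * (norm w + \<rho> \<epsilon>) + norm p * \<rho> \<epsilon>) \<longlongrightarrow> 0 * (norm w + \<rho> 0) + norm p * \<rho> 0) (at_right 0)"
      unfolding \<rho>_def by (intro tendsto_intros)
    then have "p \<bullet> w \<le> 0 * (norm w + \<rho> 0) + norm p * \<rho> 0"
    proof (rule tendsto_lowerbound)
      have "\<forall>\<^sub>F \<epsilon> in at_right 0. (0::real) < \<epsilon>" by (rule eventually_at_right_less)
      then show "\<forall>\<^sub>F \<epsilon> in at_right 0. p \<bullet> w \<le> \<epsilon> * (norm w + \<rho> \<epsilon>) + norm p * \<rho> \<epsilon>"
        by eventually_elim (rule le)
    qed simp
    then show ?thesis by (simp add: \<rho>_def c_def)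
  qed
  define K where "K = adjoint A ` (normal_cone \<Theta> (g x) \<inter> cball 0 (\<kappa> * norm p))"
  have "compact K" unfolding K_def
    by (intro compact_continuous_image linear_continuous_on linear_conv_bounded_linear[THEN iffD1]
        adjoint_linear linA closed_Int_compact closed_normal_cone compact_cball)
  moreover have "convex K" unfolding K_def
    by (intro convex_linear_image adjoint_linear linA convex_Int convex_normal_cone convex_cball)
  moreover have "p \<notin> K" using no by (auto simp: K_def)
  ultimately obtain e b where sep: "e \<bullet> p < b" "\<And>k. k \<in> K \<Longrightarrow> e \<bullet> k > b"
    using separating_hyperplane_closed_point[of K p] compact_imp_closed by blast
  \<comment> \<open>The change of sign makes \<open>p \<bullet> w\<close> exceed every value of
    \<open>w\<close> on \<open>K\<close>.\<close>
  define w where "w = - e"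
  have T: "convex T" "closed T" "0 \<in> T"
  proof -
    have "T = (\<Inter>y\<in>normal_cone \<Theta> (g x). {d. y \<bullet> d \<le> 0})" by (auto simp: T_def)
    then show "convex T" "closed T" by (auto intro: convex_INT convex_halfspace_le closed_halfspace_le)
  qed (simp add: T_def)
  define d' where "d' = closest_point T (A w)"
  define r where "r = A w - d'"
  have d'T: "d' \<in> T" unfolding d'_def using T by (intro closest_point_in_set) auto
  have proj: "r \<bullet> (t - d') \<le> 0" if "t \<in> T" for t
    unfolding r_def d'_def using T that by (intro closest_point_dot)
  \<comment> \<open>The Moreau decomposition of \<open>A w\<close>: as \<open>T\<close> is a cone,
    testing the projection at 0 and at twice \<open>d'\<close> gives orthogonality. Then
    \<open>r\<close> lies in the polar of \<open>T\<close>, and it is normal because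
    \<open>T\<close> contains all differences \<open>z - g x\<close> with \<open>z\<close> in
    \<open>\<Theta>\<close>.\<close>
  have rd: "r \<bullet> d' = 0"
  proof -
    have "2 *\<^sub>R d' \<in> T" using d'T by (auto simp: T_def mult_le_0_iff)
    from proj[OF this] proj[OF T(3)] show ?thesis by (simp add: inner_diff_right)
  qed
  have rT: "r \<bullet> t \<le> 0" if "t \<in> T" for t using proj[OF that] rd by (simp add: inner_diff_right)
  have rN: "r \<in> normal_cone \<Theta> (g x)"
    unfolding normal_cone_def using x by (auto intro!: rT simp: T_def normal_cone_def)
  \<comment> \<open>The normal of admissible length that maximizes the pairing with
    \<open>A w\<close>; for \<open>r = 0\<close> division by zero gives \<open>y = 0\<close>, which
    is consistent.\<close>
  define y where "y = (\<kappa> * norm p / norm r) *\<^sub>R r"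
  have "y \<in> normal_cone \<Theta> (g x)"
    using rN x \<kappa> by (auto simp: y_def normal_cone_def intro!: mult_nonneg_nonpos divide_nonpos_nonneg)
  moreover have "norm y \<le> \<kappa> * norm p" using \<kappa> by (simp add: y_def)
  ultimately have "adjoint A y \<in> K" by (simp add: K_def)
  then have "e \<bullet> adjoint A y > e \<bullet> p" using sep by force
  then have "A w \<bullet> y < p \<bullet> w"
    by (simp add: w_def adjoint_works[OF linA] A.neg inner_commute)
  also have "\<dots> \<le> norm p * (\<kappa> * norm r)" using bound[OF d'T, of w] by (simp add: r_def)
  also have "\<dots> = A w \<bullet> y"
  proof -
    have "A w \<bullet> r = (norm r)\<^sup>2"
      using rd by (simp add: r_def power2_norm_eq_inner inner_diff_left inner_diff_right inner_commute)
    then show ?thesis by (simp add: y_def power2_eq_square)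
  qed
  finally show False by simp
qed

subsection \<open>Second-order analysis of the constrained program\<close>

lemma tendsto_subseq:
  "X \<longlonglongrightarrow> l \<Longrightarrow> strict_mono \<tau> \<Longrightarrow> (\<lambda>k. X (\<tau> k)) \<longlonglongrightarrow> l" for \<tau> :: "nat \<Rightarrow> nat"
  using LIMSEQ_subseq_LIMSEQ[of X l \<tau>] by (simp add: o_def)

text \<open>Passing to a constant normal cone makes \<open>(ys k - y) \<bullet> (g (xs k) - g x)\<close> vanish, which disposes of
  the only term of \<open>((vs k - v) \<bullet> (xs k - x)) / (s k)\<^sup>2\<close> that is not controlled by differentiability.\<close>

lemma contingent_second_order:
  fixes g :: "'a::euclidean_space \<Rightarrow> 'b::euclidean_space" and Dg :: "'a \<Rightarrow> 'a \<Rightarrow>\<^sub>L 'b"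
  assumes poly: "polyhedron \<Theta>"
    and gradf: "(gradf has_derivative Hf) (at x)"
    and g: "(g has_derivative blinfun_apply (Dg x)) (at x)"
    and Dg: "(Dg has_derivative D2) (at x)"
    and d: "d > 0" and rem: "\<And>u. norm (u - x) < d \<Longrightarrow> norm (g u - g x - Dg x (u - x)) \<le> M * (norm (u - x))\<^sup>2"
    and N: "\<And>k::nat. ys k \<in> normal_cone \<Theta> (g (xs k))" and Y: "\<And>k. norm (ys k) \<le> Y"
    and vs: "\<And>k. vs k = gradf (xs k) + adjoint (blinfun_apply (Dg (xs k))) (ys k)"
    and s: "\<And>k. s k > 0" "s \<longlonglongrightarrow> 0"
    and w: "(\<lambda>k. (xs k - x) /\<^sub>R s k) \<longlonglongrightarrow> w" and q: "(\<lambda>k. (vs k - v) /\<^sub>R s k) \<longlonglongrightarrow> q"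
  obtains y where "y \<in> normal_cone \<Theta> (g x)" "v = gradf x + adjoint (blinfun_apply (Dg x)) y"
    "w \<in> critical_cone {x. g x \<in> \<Theta>} x (v - gradf x)" "q \<bullet> w = Hf w \<bullet> w + y \<bullet> D2 w w"
proof -
  have lin: "linear (blinfun_apply (Dg u))" for u by (rule bounded_linear.linear[OF blinfun.bounded_linear_right])
  define W where "W k = (xs k - x) /\<^sub>R s k" for k
  have xsW: "xs k - x = s k *\<^sub>R W k" for k using s(1)[of k] by (simp add: W_def)
  have W: "W \<longlonglongrightarrow> w" using w by (simp add: W_def[abs_def])
  have xs: "xs \<longlonglongrightarrow> x"
  proof -
    have "(\<lambda>k. x + s k *\<^sub>R W k) \<longlonglongrightarrow> x + 0 *\<^sub>R w" by (intro tendsto_intros s W)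
    then show ?thesis by (simp add: xsW[symmetric])
  qed
  have vlim: "vs \<longlonglongrightarrow> v"
  proof -
    have "(\<lambda>k. v + s k *\<^sub>R ((vs k - v) /\<^sub>R s k)) \<longlonglongrightarrow> v + 0 *\<^sub>R q" by (intro tendsto_intros s q)
    moreover have "v + s k *\<^sub>R ((vs k - v) /\<^sub>R s k) = vs k" for k using s(1)[of k] by simp
    ultimately show ?thesis by simp
  qed
  have "bounded (range ys)" using Y by (auto simp: bounded_iff)
  then obtain y \<tau>0 where \<tau>0: "strict_mono \<tau>0" and y0: "(ys \<circ> \<tau>0) \<longlonglongrightarrow> y"
    using bounded_imp_convergent_subsequence by metis
  have gxs: "(\<lambda>k. g (xs k)) \<longlonglongrightarrow> g x"
    using has_derivative_continuous[OF g] xs by (rule isCont_tendsto_compose)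
  have gxs0: "(\<lambda>k. g (xs (\<tau>0 k))) \<longlonglongrightarrow> g x"
    by (rule tendsto_subseq[OF gxs \<tau>0])
  have ys0: "(\<lambda>k. ys (\<tau>0 k)) \<longlonglongrightarrow> y" using y0 by (simp add: o_def)
  have yN: "y \<in> normal_cone \<Theta> (g x)"
    by (rule normal_cone_limit[OF polyhedron_imp_closed[OF poly] gxs0 ys0]) (rule N)
  obtain \<tau>1 :: "nat \<Rightarrow> nat" where \<tau>1: "strict_mono \<tau>1" "\<And>k. y \<bullet> (g (xs (\<tau>0 (\<tau>1 k))) - g x) = 0"
      "\<And>k. ys (\<tau>0 (\<tau>1 k)) \<bullet> (g (xs (\<tau>0 (\<tau>1 k))) - g x) = 0"
    using polyhedral_normal_limit[OF poly gxs0 ys0 N] by blast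
  define \<tau> where "\<tau> = \<tau>0 \<circ> \<tau>1"
  have \<tau>: "strict_mono \<tau>" unfolding \<tau>_def by (intro strict_mono_o \<tau>0 \<tau>1(1))
  have orth: "y \<bullet> (g (xs (\<tau> k)) - g x) = 0" "ys (\<tau> k) \<bullet> (g (xs (\<tau> k)) - g x) = 0" for k
    using \<tau>1(2,3)[of k] by (simp_all add: \<tau>_def)
  have ys: "(\<lambda>k. ys (\<tau> k)) \<longlonglongrightarrow> y" using LIMSEQ_subseq_LIMSEQ[OF y0 \<tau>1(1)] by (simp add: \<tau>_def o_def)
  have gradlim: "(\<lambda>k. gradf (xs (\<tau> k))) \<longlonglongrightarrow> gradf x"
    using has_derivative_continuous[OF gradf] tendsto_subseq[OF xs \<tau>] by (rule isCont_tendsto_compose)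
  have Dglim: "(\<lambda>k. Dg (xs (\<tau> k))) \<longlonglongrightarrow> Dg x"
    using has_derivative_continuous[OF Dg] tendsto_subseq[OF xs \<tau>] by (rule isCont_tendsto_compose)
  have v_inner: "vs k \<bullet> e = gradf (xs k) \<bullet> e + ys k \<bullet> Dg (xs k) e" for k e
    by (simp add: vs inner_add_left adjoint_clauses(2)[OF lin])
  \<comment> \<open>Pairing with a fixed vector \<open>e\<close> moves the adjoint onto
    \<open>e\<close>, so the limit needs convergence of \<open>Dg\<close> only.\<close>
  have v: "v = gradf x + adjoint (blinfun_apply (Dg x)) y"
  proof -
    have "v \<bullet> e = (gradf x + adjoint (blinfun_apply (Dg x)) y) \<bullet> e" for e
    proof (rule LIMSEQ_unique)
      show "(\<lambda>k. vs (\<tau> k) \<bullet> e) \<longlonglongrightarrow> v \<bullet> e" by (intro tendsto_intros tendsto_subseq[OF vlim \<tau>])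
      have "(\<lambda>k. gradf (xs (\<tau> k)) \<bullet> e + ys (\<tau> k) \<bullet> Dg (xs (\<tau> k)) e) \<longlonglongrightarrow> gradf x \<bullet> e + y \<bullet> Dg x e"
        by (intro tendsto_intros gradlim ys Dglim)
      then show "(\<lambda>k. vs (\<tau> k) \<bullet> e) \<longlonglongrightarrow> (gradf x + adjoint (blinfun_apply (Dg x)) y) \<bullet> e"
        by (simp add: v_inner inner_add_left adjoint_clauses(2)[OF lin])
    qed
    then show ?thesis using vector_eq_rdot by blast
  qed
  have feasible: "g (xs k) \<in> \<Theta>" for k using N[of k] by (auto simp: normal_cone_def split: if_splits)
  have tangent: "w \<in> tangent_cone {x. g x \<in> \<Theta>} x"
    unfolding tangent_cone_def
  proof (intro CollectI exI[of _ s] exI[of _ W] conjI allI)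
    fix k show "g (x + s k *\<^sub>R W k) \<in> \<Theta>" using feasible[of k] by (simp add: xsW[symmetric])
  qed (use s W in auto)
  have "y \<bullet> Dg x w = 0"
  proof (rule LIMSEQ_unique)
    show "(\<lambda>k. y \<bullet> ((g (xs (\<tau> k)) - g x) /\<^sub>R s (\<tau> k))) \<longlonglongrightarrow> y \<bullet> Dg x w"
      by (intro tendsto_intros tendsto_subseq[OF has_derivative_along_sequence[OF g s w] \<tau>])
    show "(\<lambda>k. y \<bullet> ((g (xs (\<tau> k)) - g x) /\<^sub>R s (\<tau> k))) \<longlonglongrightarrow> 0" by (simp add: orth)
  qed
  then have crit: "w \<in> critical_cone {x. g x \<in> \<Theta>} x (v - gradf x)"
    using tangent by (simp add: critical_cone_def v adjoint_works[OF lin] inner_commute[of _ y])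
  have "q \<bullet> w = Hf w \<bullet> w + y \<bullet> D2 w w"
  proof (rule LIMSEQ_unique)
    show "(\<lambda>k. ((vs (\<tau> k) - v) /\<^sub>R s (\<tau> k)) \<bullet> W (\<tau> k)) \<longlonglongrightarrow> q \<bullet> w"
      by (intro tendsto_intros tendsto_subseq[OF q \<tau>] tendsto_subseq[OF W \<tau>])
    \<comment> \<open>The dangerous term: the quotient
      \<open>(ys (\<tau> k) - y) /\<^sub>R s (\<tau> k)\<close> need not converge.\<close>
    define R where "R k = (ys (\<tau> k) - y) \<bullet> Dg x (W (\<tau> k)) / s (\<tau> k)" for k
    have R0: "R \<longlonglongrightarrow> 0"
    proof (rule Lim_null_comparison)
      show "(\<lambda>k. norm (ys (\<tau> k) - y) * (M * (norm (W (\<tau> k)))\<^sup>2)) \<longlonglongrightarrow> 0"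
      proof -
        have "(\<lambda>k. norm (ys (\<tau> k) - y) * (M * (norm (W (\<tau> k)))\<^sup>2)) \<longlonglongrightarrow> norm (y - y) * (M * (norm w)\<^sup>2)"
          by (intro tendsto_intros ys tendsto_subseq[OF W \<tau>])
        then show ?thesis by simp
      qed
      have "\<forall>\<^sub>F k in sequentially. norm (xs (\<tau> k) - x) < d"
        using tendstoD[OF tendsto_subseq[OF xs \<tau>] d] by (simp add: dist_norm)
      then show "\<forall>\<^sub>F k in sequentially. norm (R k) \<le> norm (ys (\<tau> k) - y) * (M * (norm (W (\<tau> k)))\<^sup>2)"
      proof eventually_elim
        case (elim k)
        define \<sigma> where "\<sigma> = s (\<tau> k)"
        have \<sigma>: "\<sigma> > 0" using s(1) by (simp add: \<sigma>_def)
        define rm where "rm = g (xs (\<tau> k)) - g x - Dg x (xs (\<tau> k) - x)"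
        have "norm rm \<le> M * (norm (xs (\<tau> k) - x))\<^sup>2" unfolding rm_def by (rule rem[OF elim])
        then have rm: "norm rm \<le> M * (norm (W (\<tau> k)))\<^sup>2 * \<sigma>\<^sup>2"
          using \<sigma> by (simp add: xsW \<sigma>_def[symmetric] power_mult_distrib mult_ac)
        \<comment> \<open>By orthogonality the increment of \<open>g\<close> drops out, so the
          linear term equals, up to sign, the Taylor remainder, which is quadratic in
          \<open>s\<close>.\<close>
        have "(ys (\<tau> k) - y) \<bullet> rm = - ((ys (\<tau> k) - y) \<bullet> Dg x (\<sigma> *\<^sub>R W (\<tau> k)))"
          using orth[of k] by (simp add: rm_def xsW \<sigma>_def inner_diff_left inner_diff_right)
        also have "\<dots> = - (\<sigma> * ((ys (\<tau> k) - y) \<bullet> Dg x (W (\<tau> k))))" by (simp add: blinfun.scaleR_right)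
        also have "\<dots> = - (\<sigma>\<^sup>2 * R k)" using \<sigma> by (simp add: R_def \<sigma>_def[symmetric] power2_eq_square)
        finally have "\<sigma>\<^sup>2 * \<bar>R k\<bar> = \<bar>(ys (\<tau> k) - y) \<bullet> rm\<bar>" by (simp add: abs_mult)
        also have "\<dots> \<le> norm (ys (\<tau> k) - y) * norm rm" by (rule Cauchy_Schwarz_ineq2)
        also have "\<dots> \<le> norm (ys (\<tau> k) - y) * (M * (norm (W (\<tau> k)))\<^sup>2 * \<sigma>\<^sup>2)"
          using rm by (intro mult_left_mono) auto
        finally have "\<sigma>\<^sup>2 * \<bar>R k\<bar> \<le> \<sigma>\<^sup>2 * (norm (ys (\<tau> k) - y) * (M * (norm (W (\<tau> k)))\<^sup>2))"
          by (simp add: mult_ac)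
        then show ?case using \<sigma> by simp
      qed
    qed
    have "(\<lambda>k. ((gradf (xs (\<tau> k)) - gradf x) /\<^sub>R s (\<tau> k)) \<bullet> W (\<tau> k)
        + ys (\<tau> k) \<bullet> ((Dg (xs (\<tau> k)) - Dg x) /\<^sub>R s (\<tau> k)) (W (\<tau> k)) + R k)
      \<longlonglongrightarrow> Hf w \<bullet> w + y \<bullet> D2 w w + 0"
      by (intro tendsto_intros ys R0 tendsto_subseq[OF W \<tau>]
          tendsto_subseq[OF has_derivative_along_sequence[OF gradf s w] \<tau>] tendsto_subseq[OF has_derivative_along_sequence[OF Dg s w] \<tau>])
    moreover have "((vs (\<tau> k) - v) /\<^sub>R s (\<tau> k)) \<bullet> W (\<tau> k)
        = ((gradf (xs (\<tau> k)) - gradf x) /\<^sub>R s (\<tau> k)) \<bullet> W (\<tau> k)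
        + ys (\<tau> k) \<bullet> ((Dg (xs (\<tau> k)) - Dg x) /\<^sub>R s (\<tau> k)) (W (\<tau> k)) + R k" for k
    proof -
      have "v \<bullet> e = gradf x \<bullet> e + y \<bullet> Dg x e" for e
        by (simp add: v inner_add_left adjoint_clauses(2)[OF lin])
      then show ?thesis
        by (simp add: R_def v_inner inner_diff_left inner_diff_right blinfun.scaleR_left blinfun.diff_left
            divide_inverse algebra_simps)
    qed
    ultimately show "(\<lambda>k. ((vs (\<tau> k) - v) /\<^sub>R s (\<tau> k)) \<bullet> W (\<tau> k)) \<longlonglongrightarrow> Hf w \<bullet> w + y \<bullet> D2 w w"
      by simp
  qed
  then show ?thesis using that yN v crit by blast
qed

section \<open>Verification of the abstract setting for the constrained program\<close>

text \<open>The mean value inequality for \<open>F - F' x\<close>, applied on the segment only,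
  where \<open>norm (z - x) \<le> norm (u - x)\<close>.\<close>

lemma lipschitz_derivative_remainder:
  fixes F :: "'a::real_normed_vector \<Rightarrow> 'b::real_normed_vector"
  assumes B: "convex B" "x \<in> B" "u \<in> B"
    and F: "\<And>z. z \<in> B \<Longrightarrow> (F has_derivative F' z) (at z)"
    and lip: "\<And>z. z \<in> B \<Longrightarrow> onorm (\<lambda>h. F' z h - F' x h) \<le> M * norm (z - x)" and M: "M \<ge> 0"
  shows "norm (F u - F x - F' x (u - x)) \<le> M * (norm (u - x))\<^sup>2"
proof -
  have seg: "closed_segment x u \<subseteq> B" using B by (simp add: closed_segment_subset)
  have "norm (F u - F x - F' x (u - x)) \<le> norm (u - x) * (M * norm (u - x))"
  proof (rule differentiable_bound_linearization[where S = "closed_segment x u"])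
    show "x + t *\<^sub>R (u - x) \<in> closed_segment x u" if "t \<in> {0..1}" for t
      using that by (auto simp: closed_segment_def algebra_simps intro!: exI[of _ t])
    show "(F has_derivative F' z) (at z within closed_segment x u)" if "z \<in> closed_segment x u" for z
      using F seg that by (blast intro: has_derivative_at_withinI)
    fix z assume z: "z \<in> closed_segment x u"
    have "norm (z - x) \<le> norm (u - x)" using segment_bound(1)[OF z] by (simp add: norm_minus_commute)
    then have "M * norm (z - x) \<le> M * norm (u - x)" using M by (intro mult_left_mono)
    then show "onorm (F' z - F' x) \<le> M * norm (u - x)" using lip[of z] z seg by (force simp: fun_diff_def)
  qed simp
  then show ?thesis by (simp add: power2_eq_square mult_ac)
qed

lemma norm_le_on_compact:
  fixes F :: "'a::topological_space \<Rightarrow> 'b::real_normed_vector"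
  assumes "compact B" "continuous_on B F"
  obtains M where "M \<ge> 0" "\<And>x. x \<in> B \<Longrightarrow> norm (F x) \<le> M"
proof -
  have "bounded (F ` B)" by (intro compact_imp_bounded compact_continuous_image assms)
  then obtain M where M: "\<And>x. x \<in> B \<Longrightarrow> norm (F x) \<le> M" by (auto simp: bounded_iff)
  show ?thesis by (rule that[of "max M 0"]) (use M in \<open>auto simp: le_max_iff_disj\<close>)
qed

text \<open>Subregularity yields multipliers bounded by a uniform \<open>Y\<close>. With them
  \<open>prox\<close> follows from \<open>y \<bullet> (g u - g x) \<le> 0\<close> and the Taylor
  remainders, and \<open>contingent\<close> from \<open>contingent_second_order\<close> combined
  with the second-order hypothesis.\<close>

lemma constrained_program_prox_regular:
  fixes f :: "'a::euclidean_space \<Rightarrow> real" and g :: "'a \<Rightarrow> 'b::euclidean_space"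
    and gradf :: "'a \<Rightarrow> 'a" and Hf :: "'a \<Rightarrow> 'a \<Rightarrow>\<^sub>L 'a"
    and Dg :: "'a \<Rightarrow> 'a \<Rightarrow>\<^sub>L 'b" and D2g :: "'a \<Rightarrow> 'a \<Rightarrow>\<^sub>L 'a \<Rightarrow>\<^sub>L 'b"
    and \<Theta> :: "'b set" and xb :: 'a and yb :: 'b and Nbh :: "'a set"
  assumes poly: "polyhedron \<Theta>"
    and Nbh: "open Nbh" "xb \<in> Nbh"
    and f: "\<And>x. x \<in> Nbh \<Longrightarrow> (f has_derivative (\<lambda>h. gradf x \<bullet> h)) (at x)"
    and gradf: "\<And>x. x \<in> Nbh \<Longrightarrow> (gradf has_derivative blinfun_apply (Hf x)) (at x)"
    and Hf_cont: "continuous_on Nbh Hf"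
    and g: "\<And>x. x \<in> Nbh \<Longrightarrow> (g has_derivative blinfun_apply (Dg x)) (at x)"
    and Dg: "\<And>x. x \<in> Nbh \<Longrightarrow> (Dg has_derivative blinfun_apply (D2g x)) (at x)"
    and D2g_cont: "continuous_on Nbh D2g"
    and feas: "g xb \<in> \<Theta>"
    and \<kappa>: "\<kappa> > 0" and \<delta>m: "\<delta>m > 0"
    and MSCQ: "\<And>x. x \<in> ball xb \<delta>m \<Longrightarrow> infdist x {x. g x \<in> \<Theta>} \<le> \<kappa> * infdist (g x) \<Theta>"
    and yb: "yb \<in> normal_cone \<Theta> (g xb)" "gradf xb + adjoint (blinfun_apply (Dg xb)) yb = 0"
    and \<sigma>: "\<sigma> \<ge> 0"
    and UV: "open U" "xb \<in> U" "open V" "0 \<in> V"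
    and second_order: "\<And>x v w y. x \<in> U \<Longrightarrow> v \<in> V \<Longrightarrow> v = gradf x + adjoint (blinfun_apply (Dg x)) y
      \<Longrightarrow> y \<in> normal_cone \<Theta> (g x) \<Longrightarrow> w \<in> critical_cone {x. g x \<in> \<Theta>} x (v - gradf x)
      \<Longrightarrow> Hf x w \<bullet> w + y \<bullet> D2g x w w \<ge> \<sigma> * (norm w)\<^sup>2"
  obtains R r where "prox_regular_constrained f {x. g x \<in> \<Theta>} xb R r \<sigma>"
proof -
  define \<Gamma> where "\<Gamma> = {x. g x \<in> \<Theta>}"
  have "open (Nbh \<inter> U)" "xb \<in> Nbh \<inter> U" using Nbh UV by auto
  then obtain e1 where e1: "e1 > 0" "cball xb e1 \<subseteq> Nbh \<inter> U" using open_contains_cball by metis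
  obtain e2 where e2: "e2 > 0" "ball 0 e2 \<subseteq> V" using UV open_contains_ball by metis
  \<comment> \<open>Half of \<open>\<delta>m\<close> is taken because subregularity is used on balls
    of radius \<open>R\<close> around points within \<open>R\<close> of \<open>xb\<close>.\<close>
  define R where "R = min e1 (min e2 (\<delta>m / 2))"
  have R: "R > 0" "2 * R \<le> \<delta>m" using e1 e2 \<delta>m by (auto simp: R_def)
  define B where "B = cball xb R"
  have B: "compact B" "convex B" "B \<subseteq> Nbh" "B \<subseteq> U"
    using e1 by (auto simp: B_def R_def)
  have inB: "u \<in> B \<longleftrightarrow> norm (u - xb) \<le> R" for u by (simp add: B_def dist_norm norm_minus_commute)
  have ball_V: "v \<in> V" if "norm v < R" for v using e2 that by (auto simp: R_def)
  have lin: "linear (blinfun_apply (Dg u))" for u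
    by (rule bounded_linear.linear[OF blinfun.bounded_linear_right])

  obtain M1 where M1: "M1 \<ge> 0" "\<And>x. x \<in> B \<Longrightarrow> norm (Hf x) \<le> M1"
    using norm_le_on_compact[OF B(1) continuous_on_subset[OF Hf_cont B(3)]] by blast
  obtain M2 where M2: "M2 \<ge> 0" "\<And>x. x \<in> B \<Longrightarrow> norm (D2g x) \<le> M2"
    using norm_le_on_compact[OF B(1) continuous_on_subset[OF D2g_cont B(3)]] by blast
  have cont_gradf: "continuous_on B gradf"
    using gradf B(3) by (meson continuous_at_imp_continuous_on has_derivative_continuous subsetD)
  obtain M0 where M0: "M0 \<ge> 0" "\<And>x. x \<in> B \<Longrightarrow> norm (gradf x) \<le> M0"
    using norm_le_on_compact[OF B(1) cont_gradf] by blast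
  have gradf_lip: "norm (gradf z - gradf x) \<le> M1 * norm (z - x)" if "x \<in> B" "z \<in> B" for x z
    by (rule differentiable_bound[OF B(2) _ _ that(2,1), of gradf "\<lambda>x. blinfun_apply (Hf x)"])
      (use gradf B(3) M1 in \<open>auto intro: has_derivative_at_withinI simp flip: norm_blinfun.rep_eq\<close>)
  have Dg_lip: "norm (Dg z - Dg x) \<le> M2 * norm (z - x)" if "x \<in> B" "z \<in> B" for x z
    by (rule differentiable_bound[OF B(2) _ _ that(2,1), of Dg "\<lambda>x. blinfun_apply (D2g x)"])
      (use Dg B(3) M2 in \<open>auto intro: has_derivative_at_withinI simp flip: norm_blinfun.rep_eq\<close>)
  have f_rem: "norm (f u - f x - gradf x \<bullet> (u - x)) \<le> M1 * (norm (u - x))\<^sup>2" if "x \<in> B" "u \<in> B" for x u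
  proof (rule lipschitz_derivative_remainder[OF B(2) that _ _ M1(1)])
    show "(f has_derivative (\<lambda>h. gradf z \<bullet> h)) (at z)" if "z \<in> B" for z using f B(3) that by blast
    fix z assume z: "z \<in> B"
    have "onorm (\<lambda>h. gradf z \<bullet> h - gradf x \<bullet> h) \<le> norm (gradf z - gradf x)"
    proof (rule onorm_le)
      show "norm (gradf z \<bullet> h - gradf x \<bullet> h) \<le> norm (gradf z - gradf x) * norm h" for h
        using Cauchy_Schwarz_ineq2[of "gradf z - gradf x" h] by (simp add: inner_diff_left)
    qed
    also have "\<dots> \<le> M1 * norm (z - x)" by (rule gradf_lip[OF that(1) z])
    finally show "onorm (\<lambda>h. gradf z \<bullet> h - gradf x \<bullet> h) \<le> M1 * norm (z - x)" .
  qed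
  have g_rem: "norm (g u - g x - Dg x (u - x)) \<le> M2 * (norm (u - x))\<^sup>2" if "x \<in> B" "u \<in> B" for x u
  proof (rule lipschitz_derivative_remainder[OF B(2) that _ _ M2(1)])
    show "(g has_derivative blinfun_apply (Dg z)) (at z)" if "z \<in> B" for z using g B(3) that by blast
    fix z assume z: "z \<in> B"
    have "onorm (\<lambda>h. Dg z h - Dg x h) = norm (Dg z - Dg x)"
      by (simp add: norm_blinfun.rep_eq minus_blinfun.rep_eq)
    then show "onorm (\<lambda>h. Dg z h - Dg x h) \<le> M2 * norm (z - x)" using Dg_lip[OF that(1) z] by simp
  qed

  have subgradient: "f x + v \<bullet> (u - x) - (M1 + norm y * M2) * (norm (u - x))\<^sup>2 \<le> f u"
    if x: "x \<in> B" and u: "u \<in> B" "u \<in> \<Gamma>" and y: "y \<in> normal_cone \<Theta> (g x)"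
      and v: "v = gradf x + adjoint (blinfun_apply (Dg x)) y" for x u y v
  proof -
    define n where "n = (norm (u - x))\<^sup>2"
    have "\<bar>f u - f x - gradf x \<bullet> (u - x)\<bar> \<le> M1 * n" using f_rem[OF x u(1)] by (simp add: n_def)
    moreover have "y \<bullet> (g u - g x) \<le> 0"
      using y u by (auto simp: normal_cone_def \<Gamma>_def split: if_splits)
    moreover have "\<bar>y \<bullet> (g u - g x - Dg x (u - x))\<bar> \<le> norm y * M2 * n"
      using Cauchy_Schwarz_ineq2[of y "g u - g x - Dg x (u - x)"]
        mult_left_mono[OF g_rem[OF x u(1)], of "norm y"] by (simp add: n_def mult.assoc)
    moreover have "v \<bullet> (u - x) = gradf x \<bullet> (u - x) + y \<bullet> Dg x (u - x)"
      by (simp add: v inner_add_left adjoint_clauses(2)[OF lin])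
    ultimately show ?thesis
      unfolding n_def[symmetric] by (simp add: inner_diff_right algebra_simps abs_le_iff)
  qed

  define Y where "Y = \<kappa> * (R + M0)"
  have frechet_multiplier: "\<exists>y\<in>normal_cone \<Theta> (g x). norm y \<le> Y \<and> v = gradf x + adjoint (blinfun_apply (Dg x)) y"
    if v: "v \<in> frechet_subdiff (constrained f \<Gamma>) x" "norm (x - xb) < R" "norm v < R" for x v
  proof -
    have xB: "x \<in> B" using that by (simp add: inB)
    have x\<Gamma>: "g x \<in> \<Theta>" using v(1) by (simp add: frechet_subdiff_constrained \<Gamma>_def)
    have "\<exists>y\<in>normal_cone \<Theta> (g x). norm y \<le> \<kappa> * norm (v - gradf x)
        \<and> adjoint (blinfun_apply (Dg x)) y = v - gradf x"
    proof (rule MSCQ_multiplier[OF poly g x\<Gamma> \<kappa> R(1)])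
      show "x \<in> Nbh" using xB B by blast
      show "infdist u {x. g x \<in> \<Theta>} \<le> \<kappa> * infdist (g u) \<Theta>" if u: "u \<in> ball x R" for u
      proof (rule MSCQ)
        have "dist xb u \<le> dist xb x + dist x u" by (rule dist_triangle)
        then show "u \<in> ball xb \<delta>m" using u R v(2) by (simp add: dist_norm norm_minus_commute)
      qed
      fix \<epsilon> :: real assume \<epsilon>: "\<epsilon> > 0"
      \<comment> \<open>\<open>\<epsilon>\<close> is shared between the subgradient inequality and
        the differentiability of \<open>f\<close>.\<close>
      obtain \<delta>1 where \<delta>1: "\<delta>1 > 0"
        "\<And>u. u \<in> \<Gamma> \<Longrightarrow> u \<in> ball x \<delta>1 \<Longrightarrow> f x + (v \<bullet> (u - x) - \<epsilon>/2 * norm (u - x)) \<le> f u"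
        using v(1) half_gt_zero[OF \<epsilon>] unfolding frechet_subdiff_constrained by (metis IntI)
      have "x \<in> Nbh" using xB B by blast
      then obtain \<delta>2 where \<delta>2: "\<delta>2 > 0"
        "\<And>u. norm (u - x) < \<delta>2 \<Longrightarrow> norm (f u - f x - gradf x \<bullet> (u - x)) \<le> \<epsilon>/2 * norm (u - x)"
        using f half_gt_zero[OF \<epsilon>] unfolding has_derivative_at_alt by blast
      have "(v - gradf x) \<bullet> (u - x) \<le> \<epsilon> * norm (u - x)"
        if u: "u \<in> {x. g x \<in> \<Theta>} \<inter> ball x (min \<delta>1 \<delta>2)" for u
      proof -
        have "u \<in> \<Gamma>" "u \<in> ball x \<delta>1" "norm (u - x) < \<delta>2"
          using u by (auto simp: \<Gamma>_def dist_norm norm_minus_commute)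
        from \<delta>1(2)[OF this(1,2)] \<delta>2(2)[OF this(3)] show ?thesis
          unfolding inner_diff_left real_norm_def by linarith
      qed
      then show "\<exists>\<delta>>0. \<forall>u\<in>{x. g x \<in> \<Theta>} \<inter> ball x \<delta>. (v - gradf x) \<bullet> (u - x) \<le> \<epsilon> * norm (u - x)"
        using \<delta>1(1) \<delta>2(1) by (intro exI[of _ "min \<delta>1 \<delta>2"]) auto
    qed
    then obtain y where y: "y \<in> normal_cone \<Theta> (g x)" "norm y \<le> \<kappa> * norm (v - gradf x)"
        "adjoint (blinfun_apply (Dg x)) y = v - gradf x" by blast
    have "norm (v - gradf x) \<le> R + M0"
      using norm_triangle_ineq4[of v "gradf x"] v(3) M0(2)[OF xB] by simp
    then have "norm y \<le> Y" using y(2) \<kappa> unfolding Y_def by (meson mult_left_mono less_imp_le order_trans)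
    then show ?thesis using y by auto
  qed
  \<comment> \<open>Limiting subgradients are reached through Frechet ones: the common bound
    \<open>Y\<close> yields a convergent subsequence of multipliers, and the graph of the normal
    cone is closed.\<close>
  have multiplier: "\<exists>y\<in>normal_cone \<Theta> (g x). norm y \<le> Y \<and> v = gradf x + adjoint (blinfun_apply (Dg x)) y"
    if v: "v \<in> limiting_subdiff (constrained f \<Gamma>) x" "norm (x - xb) < R" "norm v < R" for x v
  proof -
    obtain xs vs where xs: "xs \<longlonglongrightarrow> x" "vs \<longlonglongrightarrow> v"
      "\<And>k::nat. vs k \<in> frechet_subdiff (constrained f \<Gamma>) (xs k)"
      using v(1) unfolding limiting_subdiff_def by blast
    have "\<forall>\<^sub>F k in sequentially. norm (xs k - xb) < R"
      by (rule order_tendstoD(2)[of _ "norm (x - xb)"]) (auto intro!: tendsto_intros xs v)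
    moreover have "\<forall>\<^sub>F k in sequentially. norm (vs k) < R"
      by (rule order_tendstoD(2)[of _ "norm v"]) (auto intro!: tendsto_intros xs v)
    ultimately have "\<forall>\<^sub>F k in sequentially. norm (xs k - xb) < R \<and> norm (vs k) < R"
      by eventually_elim simp
    then obtain K where K: "\<And>k. k \<ge> K \<Longrightarrow> norm (xs k - xb) < R \<and> norm (vs k) < R"
      by (auto simp: eventually_sequentially)
    have "\<forall>k. \<exists>y\<in>normal_cone \<Theta> (g (xs (k + K))). norm y \<le> Y
        \<and> vs (k + K) = gradf (xs (k + K)) + adjoint (blinfun_apply (Dg (xs (k + K)))) y"
      using frechet_multiplier xs(3) K by auto
    then obtain ys where ys: "\<And>k. ys k \<in> normal_cone \<Theta> (g (xs (k + K)))" "\<And>k. norm (ys k) \<le> Y"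
        "\<And>k. vs (k + K) = gradf (xs (k + K)) + adjoint (blinfun_apply (Dg (xs (k + K)))) (ys k)"
      by metis
    have "bounded (range ys)" using ys(2) by (auto simp: bounded_iff)
    then obtain y \<tau> where \<tau>: "strict_mono \<tau>" and y0: "(ys \<circ> \<tau>) \<longlonglongrightarrow> y"
      using bounded_imp_convergent_subsequence by metis
    have y: "(\<lambda>k. ys (\<tau> k)) \<longlonglongrightarrow> y" using y0 by (simp add: o_def)
    have xs': "(\<lambda>k. xs (\<tau> k + K)) \<longlonglongrightarrow> x" by (rule tendsto_subseq[OF LIMSEQ_ignore_initial_segment[OF xs(1)] \<tau>])
    have vs': "(\<lambda>k. vs (\<tau> k + K)) \<longlonglongrightarrow> v" by (rule tendsto_subseq[OF LIMSEQ_ignore_initial_segment[OF xs(2)] \<tau>])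
    have xN: "x \<in> Nbh" using v(2) B by (auto simp: inB)
    have gl: "(\<lambda>k. g (xs (\<tau> k + K))) \<longlonglongrightarrow> g x"
      using has_derivative_continuous[OF g[OF xN]] xs' by (rule isCont_tendsto_compose)
    have "y \<in> normal_cone \<Theta> (g x)"
      by (rule normal_cone_limit[OF polyhedron_imp_closed[OF poly] gl y]) (rule ys(1))
    moreover have "norm y \<le> Y"
      by (rule LIMSEQ_le_const2[OF tendsto_norm[OF y]]) (use ys(2) in auto)
    moreover have "v = gradf x + adjoint (blinfun_apply (Dg x)) y"
    proof -
      have "v \<bullet> e = (gradf x + adjoint (blinfun_apply (Dg x)) y) \<bullet> e" for e
      proof (rule LIMSEQ_unique)
        show "(\<lambda>k. vs (\<tau> k + K) \<bullet> e) \<longlonglongrightarrow> v \<bullet> e" by (intro tendsto_intros vs')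
        have "(\<lambda>k. gradf (xs (\<tau> k + K)) \<bullet> e + ys (\<tau> k) \<bullet> Dg (xs (\<tau> k + K)) e) \<longlonglongrightarrow> gradf x \<bullet> e + y \<bullet> Dg x e"
          by (intro tendsto_intros y isCont_tendsto_compose[OF has_derivative_continuous[OF gradf[OF xN]] xs']
              isCont_tendsto_compose[OF has_derivative_continuous[OF Dg[OF xN]] xs'])
        then show "(\<lambda>k. vs (\<tau> k + K) \<bullet> e) \<longlonglongrightarrow> (gradf x + adjoint (blinfun_apply (Dg x)) y) \<bullet> e"
          by (simp add: ys(3) inner_add_left adjoint_clauses(2)[OF lin])
      qed
      then show ?thesis using vector_eq_rdot by blast
    qed
    ultimately show ?thesis by blast
  qed

  define r where "r = M1 + Y * M2 + 1"
  have "Y \<ge> 0" using \<kappa> R M0 by (simp add: Y_def)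
  have "prox_regular_constrained f \<Gamma> xb R r \<sigma>"
  proof unfold_locales
    show "R > 0" by (rule R)
    show "r > 0" using M1 M2 \<open>Y \<ge> 0\<close> by (simp add: r_def add_nonneg_pos)
    show "\<sigma> \<ge> 0" by (rule \<sigma>)
    have "continuous_on B g"
      using g B(3) by (meson continuous_at_imp_continuous_on has_derivative_continuous subsetD)
    then have "closed (B \<inter> g -` \<Theta>)"
      using B(1) compact_imp_closed polyhedron_imp_closed[OF poly] continuous_closed_preimage by blast
    then have "compact (B \<inter> (B \<inter> g -` \<Theta>))" using B(1) by (intro compact_Int_closed)
    also have "B \<inter> (B \<inter> g -` \<Theta>) = \<Gamma> \<inter> cball xb R" by (auto simp: \<Gamma>_def B_def)
    finally show "compact (\<Gamma> \<inter> cball xb R)" .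
    have "continuous_on B f"
      using f B(3) by (meson continuous_at_imp_continuous_on has_derivative_continuous subsetD)
    then show "continuous_on (\<Gamma> \<inter> cball xb R) f"
      by (rule continuous_on_subset) (auto simp: B_def)
    have "0 \<in> frechet_subdiff (constrained f \<Gamma>) xb"
    proof (rule proximal_imp_frechet)
      show "xb \<in> \<Gamma>" using feas by (simp add: \<Gamma>_def)
      show "f xb + 0 \<bullet> (u - xb) - (M1 + norm yb * M2) * (norm (u - xb))\<^sup>2 \<le> f u" if "u \<in> \<Gamma> \<inter> ball xb R" for u
        using that R by (intro subgradient[OF _ _ _ yb(1) yb(2)[symmetric]]) (auto simp: B_def)
    qed (rule R)
    then show "0 \<in> limiting_subdiff (constrained f \<Gamma>) xb" using frechet_subset_limiting by blast
  next
    fix x v u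
    assume v: "v \<in> limiting_subdiff (constrained f \<Gamma>) x" "norm (x - xb) < R" "norm v < R"
      and u: "u \<in> \<Gamma>" "norm (u - xb) \<le> R"
    obtain y where y: "y \<in> normal_cone \<Theta> (g x)" "norm y \<le> Y" "v = gradf x + adjoint (blinfun_apply (Dg x)) y"
      using multiplier[OF v] by blast
    have "f x + v \<bullet> (u - x) - (M1 + norm y * M2) * (norm (u - x))\<^sup>2 \<le> f u"
      using v u y by (intro subgradient) (auto simp: inB)
    moreover have "(M1 + norm y * M2) * (norm (u - x))\<^sup>2 \<le> r * (norm (u - x))\<^sup>2"
    proof (rule mult_right_mono)
      show "M1 + norm y * M2 \<le> r" using mult_right_mono[OF y(2) M2(1)] by (simp add: r_def)
    qed simp
    ultimately show "f x + v \<bullet> (u - x) - r * (norm (u - x))\<^sup>2 \<le> f u" by linarith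
  next
    fix x v xs vs s w q
    assume v: "v \<in> limiting_subdiff (constrained f \<Gamma>) x" "norm (x - xb) < R" "norm v < R"
      and vs: "\<And>k::nat. vs k \<in> limiting_subdiff (constrained f \<Gamma>) (xs k)"
        "\<And>k. norm (xs k - xb) < R" "\<And>k. norm (vs k) < R"
      and s: "\<And>k. s k > (0::real)" "s \<longlonglongrightarrow> 0"
      and w: "(\<lambda>k. (xs k - x) /\<^sub>R s k) \<longlonglongrightarrow> w" and q: "(\<lambda>k. (vs k - v) /\<^sub>R s k) \<longlonglongrightarrow> q"
    have xB: "x \<in> B" using v by (simp add: inB)
    then have xN: "x \<in> Nbh" using B by blast
    have "\<forall>k. \<exists>y\<in>normal_cone \<Theta> (g (xs k)). norm y \<le> Y \<and> vs k = gradf (xs k) + adjoint (blinfun_apply (Dg (xs k))) y"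
      using multiplier vs by blast
    then obtain ys where ys: "\<And>k. ys k \<in> normal_cone \<Theta> (g (xs k))" "\<And>k. norm (ys k) \<le> Y"
        "\<And>k. vs k = gradf (xs k) + adjoint (blinfun_apply (Dg (xs k))) (ys k)"
      by metis
    have rem: "norm (g u - g x - Dg x (u - x)) \<le> M2 * (norm (u - x))\<^sup>2" if "norm (u - x) < R - norm (x - xb)" for u
    proof (rule g_rem[OF xB])
      show "u \<in> B" using that norm_triangle_ineq[of "u - x" "x - xb"] by (simp add: inB)
    qed
    have "R - norm (x - xb) > 0" using v by simp
    from contingent_second_order[OF poly gradf[OF xN] g[OF xN] Dg[OF xN] this rem ys s w q]
    obtain y where y: "y \<in> normal_cone \<Theta> (g x)" "v = gradf x + adjoint (blinfun_apply (Dg x)) y"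
      "w \<in> critical_cone {x. g x \<in> \<Theta>} x (v - gradf x)" "q \<bullet> w = Hf x w \<bullet> w + y \<bullet> D2g x w w" by blast
    then show "\<sigma> * (norm w)\<^sup>2 \<le> q \<bullet> w"
      using second_order[of x v y w] xB B(4) ball_V[OF v(3)] by auto
  qed
  then show ?thesis using that unfolding \<Gamma>_def by blast
qed

theorem theorem8p3:
  fixes f :: "'a::euclidean_space \<Rightarrow> real" and g :: "'a \<Rightarrow> 'b::euclidean_space"
    and gradf :: "'a \<Rightarrow> 'a" and Hf :: "'a \<Rightarrow> 'a \<Rightarrow>\<^sub>L 'a"
    and Dg :: "'a \<Rightarrow> 'a \<Rightarrow>\<^sub>L 'b" and D2g :: "'a \<Rightarrow> 'a \<Rightarrow>\<^sub>L 'a \<Rightarrow>\<^sub>L 'b"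
    and \<Theta> :: "'b set" and xb :: 'a and yb :: 'b and Nbh :: "'a set"
  defines "\<Gamma> \<equiv> {x. g x \<in> \<Theta>}"
  defines "\<phi> \<equiv> \<lambda>x. ereal (f x) + indicator_ext \<Gamma> x"
  defines "\<Lambda> \<equiv> \<lambda>x v. {y. v = gradf x + adjoint (blinfun_apply (Dg x)) y
                           \<and> y \<in> normal_cone \<Theta> (g x)}"
  assumes polyh: "polyhedron \<Theta>"
    and Nbh: "open Nbh" "xb \<in> Nbh"
    and C2f: "\<forall>x\<in>Nbh. (f has_derivative (\<lambda>h. gradf x \<bullet> h)) (at x)
                    \<and> (gradf has_derivative blinfun_apply (Hf x)) (at x)"
    and C2f_cont: "continuous_on Nbh Hf"
    and C2g: "\<forall>x\<in>Nbh. (g has_derivative blinfun_apply (Dg x)) (at x)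
                    \<and> (Dg has_derivative blinfun_apply (D2g x)) (at x)"
    and C2g_cont: "continuous_on Nbh D2g"
    and feas: "g xb \<in> \<Theta>"
    and MSCQ: "\<exists>\<kappa>>0. \<exists>\<delta>>0. \<forall>x\<in>ball xb \<delta>. infdist x \<Gamma> \<le> \<kappa> * infdist (g x) \<Theta>"
    and mult: "yb \<in> normal_cone \<Theta> (g xb)"
              "gradf xb + adjoint (blinfun_apply (Dg xb)) yb = 0"
  shows
   "((\<exists>U V. open U \<and> xb \<in> U \<and> open V \<and> 0 \<in> V \<and>
        (\<forall>x\<in>U. \<forall>v\<in>V. \<forall>w. \<forall>y\<in>\<Lambda> x v. - w \<in> critical_cone \<Gamma> x (v - gradf x) \<longrightarrow>
            (Hf x w) \<bullet> w + y \<bullet> (D2g x w w) \<ge> 0))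
     \<longrightarrow> variationally_convex \<phi> xb 0
         \<and> (\<exists>\<delta>>0. \<forall>x\<in>ball xb \<delta>. g x \<in> \<Theta> \<longrightarrow> f xb \<le> f x))
  \<and> (\<forall>\<sigma>>0. (\<exists>U V. open U \<and> xb \<in> U \<and> open V \<and> 0 \<in> V \<and>
        (\<forall>x\<in>U. \<forall>v\<in>V. \<forall>w. \<forall>y\<in>\<Lambda> x v. - w \<in> critical_cone \<Gamma> x (v - gradf x) \<longrightarrow>
            (Hf x w) \<bullet> w + y \<bullet> (D2g x w w) \<ge> \<sigma> * (norm w)\<^sup>2))
     \<longrightarrow> strongly_variationally_convex \<phi> xb 0 \<sigma>
         \<and> tilt_stable \<phi> xb (1 / \<sigma>)
         \<and> (\<exists>\<kappa>>0. \<exists>\<delta>>0. \<forall>x\<in>ball xb \<delta>. g x \<in> \<Theta> \<longrightarrow>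
               f xb + \<kappa> * (norm (x - xb))\<^sup>2 \<le> f x))"
proof -
  obtain \<kappa> \<delta>m where \<kappa>: "\<kappa> > 0" "\<delta>m > 0"
    and mscq: "\<And>x. x \<in> ball xb \<delta>m \<Longrightarrow> infdist x {x. g x \<in> \<Theta>} \<le> \<kappa> * infdist (g x) \<Theta>"
    using MSCQ unfolding \<Gamma>_def by blast
  \<comment> \<open>Both parts of the theorem come from this one statement, the first with
    \<open>\<sigma> = 0\<close>.\<close>
  have regular: "\<exists>R r. prox_regular_constrained f \<Gamma> xb R r \<sigma>"
    if \<sigma>: "\<sigma> \<ge> 0" and UV: "open U" "xb \<in> U" "open V" "0 \<in> V"
      and so: "\<forall>x\<in>U. \<forall>v\<in>V. \<forall>w. \<forall>y\<in>\<Lambda> x v. - w \<in> critical_cone \<Gamma> x (v - gradf x) \<longrightarrow>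
        Hf x w \<bullet> w + y \<bullet> D2g x w w \<ge> \<sigma> * (norm w)\<^sup>2" for \<sigma> U V
  proof (rule constrained_program_prox_regular[where f = f and g = g and gradf = gradf and Hf = Hf and Dg = Dg
        and D2g = D2g and \<Theta> = \<Theta> and xb = xb and yb = yb and Nbh = Nbh and \<kappa> = \<kappa> and \<delta>m = \<delta>m
        and \<sigma> = \<sigma> and U = U and V = V])
    show "Hf x w \<bullet> w + y \<bullet> D2g x w w \<ge> \<sigma> * (norm w)\<^sup>2"
      if "x \<in> U" "v \<in> V" "v = gradf x + adjoint (blinfun_apply (Dg x)) y"
        "y \<in> normal_cone \<Theta> (g x)" "w \<in> critical_cone {x. g x \<in> \<Theta>} x (v - gradf x)" for x v w y
    proof -
      have "y \<in> \<Lambda> x v" using that by (simp add: \<Lambda>_def)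
      \<comment> \<open>The quadratic form is even in \<open>w\<close>, so the condition on
        \<open>- w\<close> in the critical cone becomes one on \<open>w\<close>.\<close>
      then show ?thesis using so[rule_format, of x v y "- w"] that
        by (simp add: \<Gamma>_def blinfun.minus_right blinfun.minus_left)
    qed
  qed (use polyh Nbh C2f C2f_cont C2g C2g_cont feas \<kappa> mscq mult \<sigma> UV in \<open>auto simp: \<Gamma>_def\<close>)
  show ?thesis
  proof (intro conjI allI impI)
    assume "\<exists>U V. open U \<and> xb \<in> U \<and> open V \<and> 0 \<in> V \<and>
        (\<forall>x\<in>U. \<forall>v\<in>V. \<forall>w. \<forall>y\<in>\<Lambda> x v. - w \<in> critical_cone \<Gamma> x (v - gradf x) \<longrightarrow>
            (Hf x w) \<bullet> w + y \<bullet> (D2g x w w) \<ge> 0)"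
    then obtain R r where "prox_regular_constrained f \<Gamma> xb R r 0" using regular[of 0] by force
    then interpret prox_regular_constrained f \<Gamma> xb R r 0 .
    \<comment> \<open>With modulus 0 the subtracted quadratic vanishes.\<close>
    have "(\<lambda>U::'a set. ereal_strongly_convex_on U 0) = ereal_convex_on"
      by (intro ext) (simp add: ereal_strongly_convex_on_def zero_ereal_def[symmetric])
    then show "variationally_convex \<phi> xb 0"
      unfolding variationally_convex_def \<phi>_def using base var_convex_gen_constrained by simp
    show "\<exists>\<delta>>0. \<forall>x\<in>ball xb \<delta>. g x \<in> \<Theta> \<longrightarrow> f xb \<le> f x"
      using quadratic_growth delta0 by (intro exI[of _ \<delta>0]) (auto simp: \<Gamma>_def dist_xb)
  next
    fix \<sigma> :: real
    assume \<sigma>: "\<sigma> > 0" and "\<exists>U V. open U \<and> xb \<in> U \<and> open V \<and> 0 \<in> V \<and>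
        (\<forall>x\<in>U. \<forall>v\<in>V. \<forall>w. \<forall>y\<in>\<Lambda> x v. - w \<in> critical_cone \<Gamma> x (v - gradf x) \<longrightarrow>
            (Hf x w) \<bullet> w + y \<bullet> (D2g x w w) \<ge> \<sigma> * (norm w)\<^sup>2)"
    then obtain R r where "prox_regular_constrained f \<Gamma> xb R r \<sigma>" using regular[of \<sigma>] by force
    then interpret prox_regular_constrained f \<Gamma> xb R r \<sigma> .
    show "strongly_variationally_convex \<phi> xb 0 \<sigma>"
      unfolding strongly_variationally_convex_def \<phi>_def using base var_convex_gen_constrained by simp
    show "tilt_stable \<phi> xb (1 / \<sigma>)" unfolding \<phi>_def by (rule tilt_stable_constrained[OF \<sigma>])
    show "\<exists>\<kappa>>0. \<exists>\<delta>>0. \<forall>x\<in>ball xb \<delta>. g x \<in> \<Theta> \<longrightarrow> f xb + \<kappa> * (norm (x - xb))\<^sup>2 \<le> f x"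
      using quadratic_growth delta0 \<sigma>
      by (intro exI[of _ "\<sigma>/2"] conjI exI[of _ \<delta>0]) (auto simp: \<Gamma>_def dist_xb)
  qed
qed

end
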